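(* Let $\alpha\in\mathbb{R}$, let $r_1,r_2,r_3,r_4\ge0$ be integers, $r=r_1+r_2+r_3+r_4$, and let $n_1>\cdots>n_{r_1}\ge0$, $m_1>\cdots>m_{r_2}\ge0$, $m_1'>\cdots>m_{r_3}'\ge0$, $n_1'>\cdots>n_{r_4}'\ge0$ be integers. Let $$\begin{aligned} f_j(x)&=L^{(\alpha)}_{n_j}(x), && j=1,\dots,r_1,\\ f_{r_1+j}(x)&=e^xL^{(\alpha)}_{m_j}(-x), && j=1,\dots,r_2,\\ f_{r_1+r_2+j}(x)&=x^{-\alpha}L^{(-\alpha)}_{m_j'}(x), && j=1,\dots,r_3,\\ f_{r_1+r_2+r_3+j}(x)&=e^xx^{-\alpha}L^{(-\alpha)}_{n_j'}(-x), && j=1,\dots,r_4, \end{aligned}$$ and consider the Maya diagrams $$M_1:\ (n_1',\dots,n_{r_4}'\mid n_1,\dots,n_{r_1}),\qquad M_2:\ (m_1',\dots,m_{r_3}'\mid m_1,\dots,m_{r_2}).$$ Let $\lambda=\lambda(M_1)$ and $\mu=\lambda(M_2)$ be the associated partitions and let $t_1=t(M_1)$, $t_2=t(M_2)$. Then $$e^{-(r_2+r_4)x}\,x^{(\alpha+r_1+r_2)(r_3+r_4)}\cdot\mathrm{Wr}[f_1,\dots,f_r](x)=C\,\Omega^{(\alpha-t_1-t_2)}_{\lambda,\mu}(x),$$ where the constant $C=C(\alpha,M_1,M_2)$ is $$C=(-1)^d\prod_{j=1}^{r_1}\prod_{k=1}^{r_3}(m_k'-\alpha-n_j)\prod_{j=1}^{r_2}\prod_{k=1}^{r_4}(n_k'-\alpha-m_j)\prod_{j=1}^{r_1}\prod_{k=1}^{r_4}(n_j+n_k'+1)\prod_{j=1}^{r_2}\prod_{k=1}^{r_3}(m_j+m_k'+1),$$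 with $$d=\begin{cases}d_0&\text{if }r_3=r_4=0,\\ d_0+d_1&\text{if }r_3=0\text{ and }r_4\ge1,\\ d_2&\text{if }r_3\ge1\text{ and }r_4=0,\\ d_1+d_2&\text{if }r_3\ge1\text{ and }r_4\ge1,\end{cases}$$ and $$\begin{aligned} d_0&=|t_2|r_2-\frac{|t_2|(|t_2|+1)}{2},\\ d_1&=\frac{r_4(r_4-1)}{2}+r_1r_4+\frac{(n_1'+1-r_4)(n_1'+2+r_4)}{2}+\sum_{i=1}^{n_1'+1-r_4}n_{r_1+i},\\ d_2&=r_2(m_1'+1)+(m_1'+1)(m_1'+1-r_3)+\sum_{i=1}^{m_1'+1-r_3}m_{r_2+i}. \end{aligned}$$ Here $(n_i)_{i\ge1}$ and $(m_i)_{i\ge1}$ are extended to the infinite strictly decreasing sequences that enumerate all elements of $M_1$ and of $M_2$, respectively.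
   Context: For $\alpha\in\mathbb{R}$ and an integer $n\ge 0$, $L^{(\alpha)}_n(x)=\frac{e^x x^{-\alpha}}{n!}\frac{d^n}{dx^n}\left(e^{-x}x^{n+\alpha}\right)$ is the Laguerre polynomial of degree $n$ (so $L_n^{(\alpha)}(x)=\sum_{k=0}^n\binom{n+\alpha}{n-k}\frac{(-x)^k}{k!}$). Powers such as $x^{-\alpha}$ are taken for $x>0$. $\mathrm{Wr}[f_1,\dots,f_r]=\det\left(\frac{d^{j-1}}{dx^{j-1}}f_i\right)_{1\le i,j\le r}$ is the Wronskian (the empty Wronskian is $1$). Empty products equal $1$ and empty sums equal $0$. A partition $\lambda=(\lambda_1,\dots,\lambda_{p})$ is a weakly decreasing (possibly empty) finite sequence of positive integers; $p$ is its length. For partitions $\lambda$ of length $p$ and $\mu$ of length $q$ and $\beta\in\mathbb{R}$, the generalized Laguerre polynomial is $$\Omega^{(\beta)}_{\lambda,\mu}(x)=e^{-qx}\,\mathrm{Wr}[g_1,\dots,g_{p+q}](x),$$ where $g_j(x)=L^{(\beta)}_{\lambda_j+p-j}(x)$ for $1\le j\le p$ and $g_{p+j}(x)=e^xL^{(\beta)}_{\mu_j+q-j}(-x)$ for $1\le j\le q$. A Maya diagram is a set $M\subset\mathbb{Z}$ containing only finitely many non-negative integers and all but finitely many negative integers. It is encoded as $M:(n_1',\dots,n_b'\mid n_1,\dots,n_a)$, where $n_1>\cdots>n_a\ge0$ are the non-negative elements of $M$ and $n_1'>\cdots>n_b'\ge0$ are the numbers $n'=-k-1$ for the negative integers $k\notin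 M$. For $t\in\mathbb{Z}$, $M+t=\{k+t:k\in M\}$. The integer $t(M)$ is the unique $t$ such that $M+t$ contains all negative integers and does not contain $0$ (so $t(M)=n_1'+1$ if $b\ge1$, and $t(M)\le0$ if $b=0$). If $N_1>\cdots>N_p\ge1$ are the non-negative elements of $M+t(M)$, then $\lambda(M)$ is the partition with $\lambda_j=N_j-p+j$, $j=1,\dots,p$. *)

theory Defs
  imports "HOL-Analysis.Analysis" "Jordan_Normal_Form.Determinant"
begin

hide_const (open) Determinants.det Finite_Cartesian_Product.mat

section \<open>Laguerre polynomials\<close>

text \<open>
  The explicit form is taken as the definition because the polynomial is also evaluated at
  negative arguments, where the Rodrigues formula (lemma \<open>laguerre_rodrigues\<close> below, valid for
  positive arguments) has no direct meaning for non-integer parameters.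
\<close>

definition laguerre :: "real \<Rightarrow> nat \<Rightarrow> real \<Rightarrow> real" where
  "laguerre \<alpha> n x = (\<Sum>k\<le>n. ((real n + \<alpha>) gchoose (n - k)) * (- x) ^ k / fact k)"

lemma higher_deriv_exp_powr:
  fixes a x :: real
  assumes "x > 0"
  shows "(deriv ^^ k) (\<lambda>t. exp (- t) * t powr a) x =
    exp (- x) * (\<Sum>i\<le>k. real (k choose i) * (- 1) ^ (k - i) * (fact i * (a gchoose i)) * x powr (a - real i))"
  using assms
proof (induction k arbitrary: x)
  case 0
  then show ?case by simp
next
  case (Suc k)
  define c where "c i = fact i * (a gchoose i)" for i
  define G where "G k y = (\<Sum>i\<le>k. real (k choose i) * (- 1) ^ (k - i) * c i * y powr (a - real i))" for k y
  have c_Suc: "c (Suc i) = c i * (a - real i)" for i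
    unfolding c_def by (simp add: gbinomial_prod_rev atLeast0LessThan mult.assoc)
  have ev: "\<forall>\<^sub>F y in nhds x. (deriv ^^ k) (\<lambda>t. exp (- t) * t powr a) y = exp (- y) * G k y"
    using eventually_nhds_in_open[of "{0<..}" x] Suc.prems
    by (auto elim!: eventually_mono simp: Suc.IH G_def c_def)
  have "((\<lambda>y. exp (- y) * G k y) has_field_derivative
     exp (- x) * (\<Sum>i\<le>k. real (k choose i) * (- 1) ^ (k - i) * c i * ((a - real i) * x powr (a - real i - 1)))
       - exp (- x) * G k x) (at x)"
    unfolding G_def using Suc.prems
    by (auto intro!: derivative_eq_intros sum.cong simp: mult_ac)
  then have D: "(deriv ^^ Suc k) (\<lambda>t. exp (- t) * t powr a) x = exp (- x) *
     ((\<Sum>i\<le>k. real (k choose i) * (- 1) ^ (k - i) * c i * ((a - real i) * x powr (a - real i - 1))) - G k x)"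
    using deriv_cong_ev[OF ev refl] by (simp add: DERIV_imp_deriv right_diff_distrib)
  have A: "(\<Sum>i\<le>k. real (k choose i) * (- 1) ^ (k - i) * c i * ((a - real i) * x powr (a - real i - 1)))
     = (\<Sum>i\<le>k. real (k choose i) * (- 1) ^ (k - i) * c (Suc i) * x powr (a - real (Suc i)))"
    by (rule sum.cong) (simp_all add: c_Suc algebra_simps)
  have B: "G k x = (\<Sum>i\<le>Suc k. real (k choose i) * (- 1) ^ (k - i) * c i * x powr (a - real i))"
    unfolding G_def by simp
  have C: "G (Suc k) x = (- 1) ^ Suc k * c 0 * x powr a + (\<Sum>i\<le>k. real (Suc k choose Suc i) * (- 1) ^ (k - i) * c (Suc i) * x powr (a - real (Suc i)))"
    unfolding G_def by (subst sum.atMost_Suc_shift) simp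
  have S: "(- 1 :: real) ^ (k - i) * real (k choose Suc i) = - ((- 1) ^ (k - Suc i) * real (k choose Suc i))"
    if "i \<le> k" for i
  proof (cases "i = k")
    case False
    with that have "k - i = Suc (k - Suc i)" by simp
    then show ?thesis by simp
  qed simp
  have "G (Suc k) x = (\<Sum>i\<le>k. real (k choose i) * (- 1) ^ (k - i) * c (Suc i) * x powr (a - real (Suc i))) - G k x"
  proof -
    have "G k x = (- 1) ^ k * c 0 * x powr a
        + (\<Sum>i\<le>k. real (k choose Suc i) * (- 1) ^ (k - Suc i) * c (Suc i) * x powr (a - real (Suc i)))"
      unfolding B by (subst sum.atMost_Suc_shift) simp
    also have "(\<Sum>i\<le>k. real (k choose Suc i) * (- 1) ^ (k - Suc i) * c (Suc i) * x powr (a - real (Suc i)))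
        = - (\<Sum>i\<le>k. real (k choose Suc i) * (- 1) ^ (k - i) * c (Suc i) * x powr (a - real (Suc i)))"
      unfolding sum_negf[symmetric]
    proof (rule sum.cong[OF refl])
      fix i assume "i \<in> {..k}"
      then have "i \<le> k" by simp
      from arg_cong[OF S[OF this], of "\<lambda>z. z * (c (Suc i) * x powr (a - real (Suc i)))"]
      show "real (k choose Suc i) * (- 1) ^ (k - Suc i) * c (Suc i) * x powr (a - real (Suc i)) =
        - (real (k choose Suc i) * (- 1) ^ (k - i) * c (Suc i) * x powr (a - real (Suc i)))"
        by (simp add: mult_ac)
    qed
    finally show ?thesis
      unfolding C by (simp add: sum.distrib distrib_right distrib_left del: of_nat_Suc)
  qed
  then show ?case
    unfolding D A by (simp add: G_def c_def)
qed

lemma laguerre_rodrigues: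
  assumes "x > 0"
  shows "laguerre \<alpha> n x =
    exp x * x powr (- \<alpha>) / fact n * (deriv ^^ n) (\<lambda>t. exp (- t) * t powr (real n + \<alpha>)) x"
proof -
  have "exp x * x powr (- \<alpha>) / fact n * (deriv ^^ n) (\<lambda>t. exp (- t) * t powr (real n + \<alpha>)) x
    = x powr (- \<alpha>) / fact n * (\<Sum>i\<le>n. real (n choose i) * (- 1) ^ (n - i) *
       (fact i * ((real n + \<alpha>) gchoose i)) * x powr (real n + \<alpha> - real i))"
    unfolding higher_deriv_exp_powr[OF assms] by (simp add: exp_minus)
  also have "\<dots> = (\<Sum>i\<le>n. ((real n + \<alpha>) gchoose i) * (- x) ^ (n - i) / fact (n - i))"
    unfolding sum_distrib_left
  proof (rule sum.cong[OF refl])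
    fix i assume "i \<in> {..n}"
    then have i: "i \<le> n" by simp
    have "x powr (- \<alpha>) * x powr (real n + \<alpha> - real i) = x ^ (n - i)"
      using assms i by (simp flip: powr_add powr_realpow add: of_nat_diff)
    moreover have "real (n choose i) * fact i / fact n = 1 / fact (n - i)"
      using i by (simp add: binomial_fact)
    moreover have "(- x) ^ (n - i) = (- 1) ^ (n - i) * x ^ (n - i)"
      by (rule power_minus)
    moreover have "x powr (- \<alpha>) / fact n * (real (n choose i) * (- 1) ^ (n - i) *
         (fact i * ((real n + \<alpha>) gchoose i)) * x powr (real n + \<alpha> - real i))
       = (real (n choose i) * fact i / fact n) * ((real n + \<alpha>) gchoose i) *
         ((- 1) ^ (n - i) * (x powr (- \<alpha>) * x powr (real n + \<alpha> - real i)))"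
      by simp
    ultimately show "x powr (- \<alpha>) / fact n * (real (n choose i) * (- 1) ^ (n - i) *
         (fact i * ((real n + \<alpha>) gchoose i)) * x powr (real n + \<alpha> - real i))
       = ((real n + \<alpha>) gchoose i) * (- x) ^ (n - i) / fact (n - i)"
      by simp
  qed
  also have "\<dots> = laguerre \<alpha> n x"
    unfolding laguerre_def by (rule sum.reindex_bij_witness[of _ "\<lambda>i. n - i" "\<lambda>i. n - i"]) auto
  finally show ?thesis by simp
qed


section \<open>Wronskians and generalized Laguerre polynomials\<close>

definition wronskian :: "(real \<Rightarrow> real) list \<Rightarrow> real \<Rightarrow> real" where
  "wronskian fs x = det (mat (length fs) (length fs) (\<lambda>(i, j). (deriv ^^ j) (fs ! i) x))"

text \<open>
  Partitions are weakly decreasing lists of positive integers. List positions start at 0, so the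
  paper's $\lambda_j + p - j$ is \<open>lam ! j + (length lam - (j + 1))\<close>.
\<close>

definition generalized_laguerre :: "real \<Rightarrow> nat list \<Rightarrow> nat list \<Rightarrow> real \<Rightarrow> real" where
  "generalized_laguerre \<beta> lam mu x =
     (let p = length lam; q = length mu in
      exp (- real q * x) *
      wronskian
        (map (\<lambda>j x. laguerre \<beta> (lam ! j + (p - (j + 1))) x) [0..<p] @
         map (\<lambda>j x. exp x * laguerre \<beta> (mu ! j + (q - (j + 1))) (- x)) [0..<q]) x)"


section \<open>Maya diagrams\<close>

definition maya_diagram :: "int set \<Rightarrow> bool" where
  "maya_diagram M \<longleftrightarrow> finite (M \<inter> {0..}) \<and> finite ({..<0} - M)"

text \<open>The diagram $M : (n'_1,\dots,n'_b \mid n_1,\dots,n_a)$.\<close>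

definition maya_of :: "nat list \<Rightarrow> nat list \<Rightarrow> int set" where
  "maya_of n' n = int ` set n \<union> {k. k < 0 \<and> nat (- k - 1) \<notin> set n'}"

definition maya_shift :: "int set \<Rightarrow> int \<Rightarrow> int set" where
  "maya_shift M t = (\<lambda>k. k + t) ` M"

definition maya_t :: "int set \<Rightarrow> int" where
  "maya_t M = (THE t. {..<0} \<subseteq> maya_shift M t \<and> 0 \<notin> maya_shift M t)"

definition maya_partition :: "int set \<Rightarrow> nat list" where
  "maya_partition M =
     (let N = rev (sorted_list_of_set (nat ` (maya_shift M (maya_t M) \<inter> {0..}))); p = length N
      in map (\<lambda>j. N ! j + (j + 1) - p) [0..<p])"

text \<open>
  The elements of \<open>M\<close> in decreasing order, counted from 1: \<open>maya_enum M 1\<close> is the largest element.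
\<close>

definition maya_enum :: "int set \<Rightarrow> nat \<Rightarrow> int" where
  "maya_enum M i = (THE s. (\<forall>i j. i < j \<longrightarrow> s j < s i) \<and> range s = M) (i - 1)"

lemma maya_diagram_maya_of: "maya_diagram (maya_of n' n)"
proof -
  have "maya_of n' n \<inter> {0..} \<subseteq> int ` set n"
    by (auto simp: maya_of_def)
  moreover have "{..<0} - maya_of n' n \<subseteq> (\<lambda>k. - int k - 1) ` set n'"
  proof
    fix k assume "k \<in> {..<0} - maya_of n' n"
    then have "nat (- k - 1) \<in> set n'" "k = - int (nat (- k - 1)) - 1"
      by (auto simp: maya_of_def)
    then show "k \<in> (\<lambda>k. - int k - 1) ` set n'" by (rule rev_image_eqI)
  qed
  ultimately show ?thesis
    unfolding maya_diagram_def by (meson finite_subset finite_imageI finite_set)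
qed

lemma maya_of_nonneg: "maya_of n' n \<inter> {0..} = int ` set n"
  by (auto simp: maya_of_def)

lemma maya_of_holes: "{k. - int k - 1 \<notin> maya_of n' n} = set n'"
proof -
  have "- int k - 1 \<notin> int ` set n" "nat (- (- int k - 1) - 1) = k" for k by auto
  then show ?thesis by (auto simp: maya_of_def)
qed

lemma maya_of_encoding:
  assumes "maya_diagram M"
    and "set n = {k. int k \<in> M}" and "set n' = {k. - int k - 1 \<notin> M}"
  shows "maya_of n' n = M"
proof (intro Set.set_eqI)
  fix k
  show "k \<in> maya_of n' n \<longleftrightarrow> k \<in> M"
  proof (cases "k < 0")
    case True
    then have "- int (nat (- k - 1)) - 1 = k" by simp
    with True show ?thesis by (auto simp: maya_of_def assms)
  next
    case False
    then have "int (nat k) = k" by simp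
    moreover from this have "k \<in> int ` set n \<longleftrightarrow> nat k \<in> set n" by (metis image_iff nat_int)
    ultimately show ?thesis using False by (simp add: maya_of_def assms)
  qed
qed

lemma maya_diagram_bounds:
  assumes "maya_diagram M"
  obtains l u where "\<And>k. k < l \<Longrightarrow> k \<in> M" "\<And>k. k \<in> M \<Longrightarrow> k < u"
proof
  have fin: "finite (M \<inter> {0..})" "finite ({..<0} - M)"
    using assms by (auto simp: maya_diagram_def)
  show "k \<in> M" if "k < Min (insert 0 ({..<0} - M))" for k
    using that fin by (subst (asm) Min_gr_iff) auto
  show "k < Max (insert 0 (M \<inter> {0..})) + 1" if "k \<in> M" for k
  proof (cases "k \<ge> 0")
    case True
    with that fin have "k \<le> Max (insert 0 (M \<inter> {0..}))" by (intro Max_ge) auto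
    then show ?thesis by simp
  next
    case False
    moreover have "0 \<le> Max (insert 0 (M \<inter> {0..}))" using fin by (intro Max_ge) auto
    ultimately show ?thesis by simp
  qed
qed

lemma maya_t_unique:
  assumes "maya_diagram M"
  shows "\<exists>!t. {..<0} \<subseteq> maya_shift M t \<and> 0 \<notin> maya_shift M t"
proof -
  have mem: "x \<in> maya_shift M t \<longleftrightarrow> x - t \<in> M" for x t
    unfolding maya_shift_def by (force intro: rev_image_eqI)
  have eq: "{..<0} \<subseteq> maya_shift M t \<and> 0 \<notin> maya_shift M t \<longleftrightarrow> (\<forall>k < - t. k \<in> M) \<and> - t \<notin> M" for t
  proof -
    have "(\<forall>k < 0. k - t \<in> M) \<longleftrightarrow> (\<forall>k < - t. k \<in> M)"
      by (metis add.commute add_diff_cancel diff_add_cancel diff_less_0_iff_less diff_minus_eq_add)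
    then show ?thesis by (auto simp: mem subset_eq)
  qed
  obtain l u where lu: "\<And>k. k < l \<Longrightarrow> k \<in> M" "\<And>k. k \<in> M \<Longrightarrow> k < u"
    using maya_diagram_bounds[OF assms] by metis
  define P where "P i \<longleftrightarrow> l + int i \<notin> M" for i
  have "l \<le> u" using lu by force
  then have "P (nat (u - l))" using lu unfolding P_def by force
  then have P: "P (Least P)" by (rule LeastI)
  have "(\<forall>k < l + int (Least P). k \<in> M)"
  proof (intro allI impI)
    fix k assume k: "k < l + int (Least P)"
    show "k \<in> M"
    proof (cases "k < l")
      case False
      then have "\<not> P (nat (k - l))" using k by (intro not_less_Least) auto
      then show ?thesis using False by (simp add: P_def)
    qed (use lu in auto)
  qed
  then have ex: "\<exists>t. (\<forall>k < - t. k \<in> M) \<and> - t \<notin> M"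
    using P[unfolded P_def[of "Least P"]] by (intro exI[of _ "- (l + int (Least P))"]) (simp add: add.commute)
  have un: "t = t'" if "(\<forall>k < - t. k \<in> M) \<and> - t \<notin> M" "(\<forall>k < - t'. k \<in> M) \<and> - t' \<notin> M" for t t'
  proof -
    have "\<not> - t < - t'" "\<not> - t' < - t" using that by blast+
    then show ?thesis by simp
  qed
  show ?thesis unfolding eq using ex un by (rule ex_ex1I)
qed

lemma maya_enum_unique:
  assumes "maya_diagram M"
  shows "\<exists>!s :: nat \<Rightarrow> int. (\<forall>i j. i < j \<longrightarrow> s j < s i) \<and> range s = M"
proof (rule ex_ex1I)
  obtain l u where lu: "\<And>k. k < l \<Longrightarrow> k \<in> M" "\<And>k. k \<in> M \<Longrightarrow> k < u"
    using maya_diagram_bounds[OF assms] by metis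
  define S where "S = {i. u - int i \<in> M}"
  have "infinite S"
    unfolding infinite_nat_iff_unbounded
  proof
    fix m
    show "\<exists>n>m. n \<in> S"
      using lu(1) by (intro exI[of _ "Suc m + nat (u - l + 1)"]) (auto simp: S_def)
  qed
  have "range (\<lambda>i. u - int (enumerate S i)) = (\<lambda>i. u - int i) ` S"
    using range_enumerate[OF \<open>infinite S\<close>] by (metis image_image)
  also have "\<dots> = M"
  proof
    show "M \<subseteq> (\<lambda>i. u - int i) ` S"
    proof
      fix k assume "k \<in> M"
      then show "k \<in> (\<lambda>i. u - int i) ` S"
        using lu(2)[of k] by (intro image_eqI[of _ _ "nat (u - k)"]) (auto simp: S_def)
    qed
  qed (auto simp: S_def)
  finally show "\<exists>s :: nat \<Rightarrow> int. (\<forall>i j. i < j \<longrightarrow> s j < s i) \<and> range s = M"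
    using enumerate_mono[OF _ \<open>infinite S\<close>]
    by (intro exI[of _ "\<lambda>i. u - int (enumerate S i)"]) auto
next
  have le: "s i \<le> s' i" if s: "\<forall>i j. i < j \<longrightarrow> s j < s i" "range s = M"
    and s': "\<forall>i j. i < j \<longrightarrow> s' j < s' i" "range s' = M" and "\<And>j. j < i \<Longrightarrow> s j = s' j"
    for s s' :: "nat \<Rightarrow> int" and i
  proof -
    have "s i \<in> range s'" using s s' by auto
    then obtain j where j: "s i = s' j" by auto
    show ?thesis
      using that j by (metis less_le linorder_neqE_nat order_refl)
  qed
  fix s s' :: "nat \<Rightarrow> int"
  assume A: "(\<forall>i j. i < j \<longrightarrow> s j < s i) \<and> range s = M" "(\<forall>i j. i < j \<longrightarrow> s' j < s' i) \<and> range s' = M"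
  show "s = s'"
  proof
    fix i show "s i = s' i"
    proof (induction i rule: less_induct)
      case (less i)
      then show ?case using A le[of s s' i] le[of s' s i] by (simp add: order_antisym)
    qed
  qed
qed

end

theory Submission
  imports Defs
begin

text \<open>
  Each of the four families contains, at index 0, one of the functions $1$, $e^x$, $x^{-\alpha}$,
  $e^x x^{-\alpha}$. Dividing all functions of a Wronskian by such a member $\varphi$ turns it into
  the constant 1, so the Wronskian reduces to that of the derivatives $(f_j/\varphi)'$. By the
  contiguity relations these are again, up to constant factors and a common factor, members of the
  four families with $\alpha$ replaced by $\alpha \pm 1$, and the indices change exactly as when one
  of the two Maya diagrams is shifted by $\mp 1$. The partitions and $\alpha - t_1 - t_2$ are
  invariant under these shifts, so the identity propagates from the diagrams with $t_1 = t_2 = 0$,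
  where it is the definition of $\Omega$. Deducing the identity for the shorter Wronskian from the
  one for the longer requires dividing by $\prod_k (m'_k - \alpha)$, which can vanish only for
  integer $\alpha$; these parameters are reached by continuity in $\alpha$. In closed form the accumulated sign is
  $(-1)^{r_1 r_4 + \sum_k n'_k + \binom{c}{2} + \sum_k (m'_k + 1) + \binom{q}{2}}$ with
  $c = r_2 - r_3$ and $q$ the length of $\mu$; it agrees with $(-1)^d$.
\<close>

section \<open>Wronskians of smooth functions\<close>

lemma higher_deriv_cong_open:
  fixes f g :: "real \<Rightarrow> real"
  assumes "open S" "x \<in> S" "\<And>y. y \<in> S \<Longrightarrow> f y = g y"
  shows "(deriv ^^ j) f x = (deriv ^^ j) g x"
  using assms eventually_nhds_in_open[of S x]
  by (intro higher_deriv_cong_ev refl) (auto elim!: eventually_mono)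

text \<open>\<open>deriv\<close> returns a value even where no derivative exists, so smoothness is
  expressed as differentiability of every iterate. The lemmas that transfer derivatives between
  functions agreeing on \<open>S\<close> add that \<open>S\<close> is open.\<close>

definition smooth_on :: "real set \<Rightarrow> (real \<Rightarrow> real) \<Rightarrow> bool" where
  "smooth_on S f \<longleftrightarrow> (\<forall>j. \<forall>y\<in>S. (deriv ^^ j) f field_differentiable at y)"

lemma smooth_onD:
  assumes "smooth_on S f" "y \<in> S"
  shows "((deriv ^^ j) f has_field_derivative (deriv ^^ Suc j) f y) (at y)"
  using assms by (auto simp: smooth_on_def field_differentiable_derivI)

lemma smooth_on_cong:
  assumes "open S" "\<And>y. y \<in> S \<Longrightarrow> f y = g y" "smooth_on S f"
  shows "smooth_on S g"
  unfolding smooth_on_def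
proof (intro allI ballI)
  fix j y assume y: "y \<in> S"
  have "((deriv ^^ j) g has_field_derivative (deriv ^^ Suc j) f y) (at y)"
    using smooth_onD[OF assms(3) y] assms(1) y
    by (rule has_field_derivative_transform_within_open) (rule higher_deriv_cong_open[OF assms(1) _ assms(2)])
  then show "(deriv ^^ j) g field_differentiable at y"
    by (auto simp: field_differentiable_def)
qed

text \<open>If a family is closed under differentiation on \<open>S\<close>, induction shows that
  every iterated derivative of a member agrees on \<open>S\<close> with some member, which is again
  differentiable. Smoothness proofs thus reduce to exhibiting such a family.\<close>

lemma smooth_on_coinduct:
  assumes S: "open S" and "f \<in> F"
    and closed: "\<And>f. f \<in> F \<Longrightarrow> \<exists>g\<in>F. \<forall>y\<in>S. (f has_field_derivative g y) (at y)"
  shows "smooth_on S f"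
proof -
  have "\<exists>g\<in>F. \<forall>y\<in>S. (deriv ^^ j) f y = g y" for j
  proof (induction j)
    case 0
    show ?case using assms(2) by auto
  next
    case (Suc j)
    then obtain g where g: "g \<in> F" "\<forall>y\<in>S. (deriv ^^ j) f y = g y" by blast
    from closed[OF g(1)] obtain h where h: "h \<in> F" "\<forall>y\<in>S. (g has_field_derivative h y) (at y)" by blast
    have "(deriv ^^ Suc j) f y = h y" if "y \<in> S" for y
    proof -
      have "deriv ((deriv ^^ j) f) y = deriv g y"
        using g that S by (intro deriv_cong_ev refl) (auto intro!: eventually_mono[OF eventually_nhds_in_open[of S y]])
      then show ?thesis using h that by (simp add: DERIV_imp_deriv)
    qed
    with h show ?case by blast
  qed
  then show ?thesis
    unfolding smooth_on_def
  proof (intro allI ballI)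
    fix j y assume y: "y \<in> S" and *: "\<And>j. \<exists>g\<in>F. \<forall>y\<in>S. (deriv ^^ j) f y = g y"
    obtain g where g: "g \<in> F" "\<forall>y\<in>S. (deriv ^^ j) f y = g y" using * by blast
    from closed[OF g(1)] obtain h where h: "h \<in> F" "\<forall>y\<in>S. (g has_field_derivative h y) (at y)" by blast
    have "((deriv ^^ j) f has_field_derivative h y) (at y)"
      using bspec[OF h(2) y] S y
      by (rule has_field_derivative_transform_within_open) (use g in simp)
    then show "(deriv ^^ j) f field_differentiable at y"
      by (auto simp: field_differentiable_def)
  qed
qed

lemma higher_deriv_mult_real:
  assumes S: "open S" and f: "smooth_on S f" and g: "smooth_on S g" and y: "y \<in> S"
  shows "(deriv ^^ j) (\<lambda>y. f y * g y) y =
    (\<Sum>i\<le>j. of_nat (j choose i) * (deriv ^^ i) f y * (deriv ^^ (j - i)) g y)"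
  using y
proof (induction j arbitrary: y)
  case 0
  then show ?case by simp
next
  case (Suc j)
  note f' = smooth_onD[OF f Suc.prems] and g' = smooth_onD[OF g Suc.prems]
  have "(deriv ^^ Suc j) (\<lambda>y. f y * g y) y =
      deriv (\<lambda>y. \<Sum>i\<le>j. of_nat (j choose i) * (deriv ^^ i) f y * (deriv ^^ (j - i)) g y) y"
    using Suc S by (auto intro!: deriv_cong_ev eventually_mono[OF eventually_nhds_in_open[of S y]])
  also have "\<dots> = (\<Sum>i\<le>j. of_nat (j choose i) *
      ((deriv ^^ Suc i) f y * (deriv ^^ (j - i)) g y + (deriv ^^ i) f y * (deriv ^^ Suc (j - i)) g y))"
    by (intro DERIV_imp_deriv)
      (auto intro!: derivative_eq_intros f'[simplified] g'[simplified] sum.cong simp: algebra_simps)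
  also have "\<dots> = (\<Sum>i\<le>j. of_nat (j choose i) * (deriv ^^ Suc i) f y * (deriv ^^ (j - i)) g y)
      + (\<Sum>i\<le>j. of_nat (j choose i) * (deriv ^^ i) f y * (deriv ^^ (Suc j - i)) g y)"
    by (simp add: sum.distrib distrib_left Suc_diff_le mult.assoc)
  \<comment> \<open>The added summand \<open>Suc j\<close> has coefficient
    \<open>j choose Suc j = 0\<close>. Splitting off index 0 afterwards aligns the two sums for
    Pascal's rule.\<close>
  also have "(\<Sum>i\<le>j. of_nat (j choose i) * (deriv ^^ i) f y * (deriv ^^ (Suc j - i)) g y)
      = (\<Sum>i\<le>Suc j. of_nat (j choose i) * (deriv ^^ i) f y * (deriv ^^ (Suc j - i)) g y)"
    by simp
  also have "\<dots> = f y * (deriv ^^ Suc j) g y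
      + (\<Sum>i\<le>j. of_nat (j choose Suc i) * (deriv ^^ Suc i) f y * (deriv ^^ (j - i)) g y)"
    by (subst sum.atMost_Suc_shift) simp
  finally show ?case
    by (subst sum.atMost_Suc_shift) (simp add: sum.distrib distrib_right del: funpow.simps)
qed

lemma smooth_on_mult:
  assumes S: "open S" and f: "smooth_on S f" and g: "smooth_on S g"
  shows "smooth_on S (\<lambda>y. f y * g y)"
  unfolding smooth_on_def
proof (intro allI ballI)
  fix j y assume y: "y \<in> S"
  have "(\<lambda>y. \<Sum>i\<le>j. of_nat (j choose i) * (deriv ^^ i) f y * (deriv ^^ (j - i)) g y) field_differentiable at y"
    using f g y unfolding smooth_on_def by (auto intro!: derivative_intros)
  then obtain D where
    "((\<lambda>y. \<Sum>i\<le>j. of_nat (j choose i) * (deriv ^^ i) f y * (deriv ^^ (j - i)) g y) has_field_derivative D) (at y)"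
    by (auto simp: field_differentiable_def)
  then have "((deriv ^^ j) (\<lambda>y. f y * g y) has_field_derivative D) (at y)"
    using S y by (rule has_field_derivative_transform_within_open) (simp add: higher_deriv_mult_real[OF S f g])
  then show "(deriv ^^ j) (\<lambda>y. f y * g y) field_differentiable at y"
    by (auto simp: field_differentiable_def)
qed

lemma higher_deriv_cmult_real:
  assumes S: "open S" and f: "smooth_on S f" and y: "y \<in> S"
  shows "(deriv ^^ j) (\<lambda>y. c * f y) y = c * (deriv ^^ j) f y"
  using y
proof (induction j arbitrary: y)
  case (Suc j)
  have "(deriv ^^ Suc j) (\<lambda>y. c * f y) y = deriv (\<lambda>y. c * (deriv ^^ j) f y) y"
    using Suc S by (auto intro!: deriv_cong_ev eventually_mono[OF eventually_nhds_in_open[of S y]])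
  also have "\<dots> = c * (deriv ^^ Suc j) f y"
    using smooth_onD[OF f Suc.prems] by (intro DERIV_imp_deriv DERIV_cmult)
  finally show ?case .
qed simp

section \<open>Scaling, gauge and reduction rules for Wronskians\<close>

lemma wronskian_cong:
  assumes "open S" "x \<in> S" and len: "length fs = length gs"
    and "\<And>i y. i < length gs \<Longrightarrow> y \<in> S \<Longrightarrow> (fs ! i) y = (gs ! i) y"
  shows "wronskian fs x = wronskian gs x"
  unfolding wronskian_def len
  by (intro arg_cong[of _ _ det] cong_mat) (auto intro!: higher_deriv_cong_open[OF assms(1,2)] assms(4))

lemma wronskian_map_cmult:
  assumes S: "open S" "x \<in> S" and g: "\<And>p. p \<in> set ps \<Longrightarrow> smooth_on S (g p)"
  shows "wronskian (map (\<lambda>p y. c p * g p y) ps) x = prod_list (map c ps) * wronskian (map g ps) x"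
proof -
  let ?n = "length ps"
  have "wronskian (map (\<lambda>p y. c p * g p y) ps) x
      = det (mat ?n ?n (\<lambda>(i, j). c (ps ! i) * (deriv ^^ j) (g (ps ! i)) x))"
    unfolding wronskian_def length_map
    by (intro arg_cong[of _ _ det] cong_mat) (auto intro!: higher_deriv_cmult_real[OF S(1) _ S(2)] g)
  also have "\<dots> = (\<Prod>i = 0..<?n. c (ps ! i)) * det (mat ?n ?n (\<lambda>(i, j). (deriv ^^ j) (g (ps ! i)) x))"
    unfolding det_def
    by (auto simp: sum_distrib_left prod.distrib mult_ac permutes_def intro!: sum.cong prod.cong)
  also have "mat ?n ?n (\<lambda>(i, j). (deriv ^^ j) (g (ps ! i)) x) =
      mat (length (map g ps)) (length (map g ps)) (\<lambda>(i, j). (deriv ^^ j) (map g ps ! i) x)"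
    by (rule eq_matI) auto
  finally show ?thesis
    by (simp add: wronskian_def prod.list_conv_set_nth)
qed

text \<open>The Leibniz rule is a matrix factorization: the derivative matrix of the products is
  that of \<open>fs\<close> times an upper triangular matrix with \<open>h x\<close> along its
  diagonal.\<close>

lemma wronskian_gauge:
  assumes S: "open S" "x \<in> S" and h: "smooth_on S h" and fs: "\<And>f. f \<in> set fs \<Longrightarrow> smooth_on S f"
  shows "wronskian (map (\<lambda>f y. h y * f y) fs) x = h x ^ length fs * wronskian fs x"
proof -
  let ?n = "length fs"
  let ?A = "mat ?n ?n (\<lambda>(i, j). (deriv ^^ j) (fs ! i) x)"
  let ?U = "mat ?n ?n (\<lambda>(i, j). of_nat (j choose i) * (deriv ^^ (j - i)) h x)"
  have "wronskian (map (\<lambda>f y. h y * f y) fs) x = det (?A * ?U)"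
    unfolding wronskian_def length_map
  proof (intro arg_cong[of _ _ det] eq_matI)
    fix i j assume "i < dim_row (?A * ?U)" "j < dim_col (?A * ?U)"
    then have ij: "i < ?n" "j < ?n" by auto
    have "(deriv ^^ j) (\<lambda>y. h y * (fs ! i) y) x
        = (deriv ^^ j) (\<lambda>y. (fs ! i) y * h y) x"
      by (simp add: mult.commute)
    also have "\<dots> = (\<Sum>k\<le>j. of_nat (j choose k) * (deriv ^^ k) (fs ! i) x * (deriv ^^ (j - k)) h x)"
      using ij by (intro higher_deriv_mult_real[OF S(1) fs h S(2)]) auto
    \<comment> \<open>The new terms, with \<open>k > j\<close>, vanish because
      \<open>j choose k = 0\<close>; the sum becomes an entry of the full matrix product.\<close>
    also have "\<dots> = (\<Sum>k = 0..<?n. (deriv ^^ k) (fs ! i) x * (of_nat (j choose k) * (deriv ^^ (j - k)) h x))"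
      using ij by (intro sum.mono_neutral_cong_left) (auto simp: binomial_eq_0)
    finally show "mat ?n ?n (\<lambda>(i, j). (deriv ^^ j) (map (\<lambda>f y. h y * f y) fs ! i) x) $$ (i, j)
        = (?A * ?U) $$ (i, j)"
      using ij by (simp add: scalar_prod_def)
  qed auto
  also have "\<dots> = det ?A * det ?U"
    by (rule det_mult[of _ ?n]) auto
  also have "det ?U = prod_list (diag_mat ?U)"
    by (rule det_upper_triangular[of _ ?n]) (auto simp: upper_triangular_def binomial_eq_0)
  also have "diag_mat ?U = replicate ?n (h x)"
    by (auto simp: diag_mat_def intro!: nth_equalityI)
  finally show ?thesis
    by (simp add: wronskian_def)
qed

text \<open>The row of the constant 1 is (1, 0, ..., 0), so Laplace expansion along it leaves a
  single cofactor.\<close>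

lemma wronskian_remove_one:
  "wronskian (fs @ (\<lambda>_. 1) # gs) x = (- 1) ^ length fs * wronskian (map deriv (fs @ gs)) x"
proof -
  let ?n = "Suc (length (fs @ gs))" and ?l = "fs @ (\<lambda>_. 1) # gs"
  let ?A = "mat ?n ?n (\<lambda>(i, j). (deriv ^^ j) (?l ! i) x)"
  let ?i = "length fs"
  have one: "(deriv ^^ j) (\<lambda>_. 1) x = (if j = 0 then 1 else 0 :: real)" for j and x :: real
  proof (cases j)
    case (Suc k)
    have "(deriv ^^ k) (\<lambda>_. 0) = (\<lambda>_. 0 :: real)" by (induction k) simp_all
    then show ?thesis by (simp add: Suc funpow_swap1)
  qed simp
  have "wronskian ?l x = (\<Sum>j<?n. ?A $$ (?i, j) * cofactor ?A ?i j)"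
    unfolding wronskian_def by (subst laplace_expansion_row[of _ ?n ?i]) auto
  also have "\<dots> = (\<Sum>j<?n. if j = 0 then cofactor ?A ?i 0 else 0)"
    by (intro sum.cong) (auto simp: one)
  also have "\<dots> = cofactor ?A ?i 0" by simp
  \<comment> \<open>Without column 0 only derivatives of order at least one remain, which is the
    Wronskian matrix of the derivatives.\<close>
  also have "mat_delete ?A ?i 0 = mat (length (fs @ gs)) (length (fs @ gs))
      (\<lambda>(i, j). (deriv ^^ j) (map deriv (fs @ gs) ! i) x)"
    by (rule eq_matI) (auto simp: mat_delete_def nth_append Suc_diff_le funpow_swap1)
  then have "cofactor ?A ?i 0 = (- 1) ^ ?i * wronskian (map deriv (fs @ gs)) x"
    by (simp add: cofactor_def wronskian_def)
  finally show ?thesis .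
qed

section \<open>Contiguity relations and removal of a seed function\<close>

text \<open>This is the derivative in x. The case split prevents the lowered index from being
  truncated at 0.\<close>

definition laguerre' :: "real \<Rightarrow> nat \<Rightarrow> real \<Rightarrow> real" where
  "laguerre' \<alpha> n x = (case n of 0 \<Rightarrow> 0 | Suc k \<Rightarrow> - laguerre (\<alpha> + 1) k x)"

lemma laguerre_0 [simp]: "laguerre \<alpha> 0 x = 1"
  by (simp add: laguerre_def)

lemma has_field_derivative_laguerre:
  "(laguerre \<alpha> n has_field_derivative laguerre' \<alpha> n x) (at x)"
proof (cases n)
  case 0
  moreover have "laguerre \<alpha> 0 = (\<lambda>_. 1)" by auto
  ultimately show ?thesis by (simp add: laguerre'_def)
next
  case (Suc m)
  have D: "((\<lambda>x. c * (- x) ^ k / fact k) has_field_derivative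
      (if k = 0 then 0 else - c * (- x) ^ (k - 1) / fact (k - 1))) (at x)" for c and k :: nat
  proof (cases k)
    case (Suc m)
    have "((\<lambda>x. (- x) ^ Suc m) has_field_derivative real (Suc m) * (- 1 * (- x) ^ m)) (at x)"
      using DERIV_power[of uminus "- 1" x UNIV "Suc m"] by (simp add: DERIV_minus)
    then have "((\<lambda>x. c * (- x) ^ Suc m / fact (Suc m)) has_field_derivative
        c * (real (Suc m) * (- 1 * (- x) ^ m)) / fact (Suc m)) (at x)"
      by (intro DERIV_cdivide DERIV_cmult)
    then show ?thesis by (simp add: Suc del: of_nat_Suc)
  qed simp
  have "((\<lambda>x. \<Sum>k\<le>n. ((real n + \<alpha>) gchoose (n - k)) * (- x) ^ k / fact k) has_field_derivative
      (\<Sum>k\<le>n. if k = 0 then 0 else - ((real n + \<alpha>) gchoose (n - k)) * (- x) ^ (k - 1) / fact (k - 1))) (at x)"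
    by (intro DERIV_sum D)
  also have "(\<Sum>k\<le>n. if k = 0 then 0 else - ((real n + \<alpha>) gchoose (n - k)) * (- x) ^ (k - 1) / fact (k - 1))
      = laguerre' \<alpha> n x"
    unfolding Suc by (subst sum.atMost_Suc_shift) (simp add: laguerre'_def laguerre_def sum_negf add_ac)
  finally show ?thesis by (simp add: laguerre_def[abs_def])
qed

text \<open>Pascal's rule for generalized binomial coefficients splits L_n with parameter
  \<open>\<alpha> + 1\<close> into L_(n-1) with parameter \<open>\<alpha> + 1\<close> and L_n with
  parameter \<alpha>.\<close>

lemma laguerre'_minus_laguerre: "laguerre' \<alpha> n x - laguerre \<alpha> n x = - laguerre (\<alpha> + 1) n x"
proof (cases n)
  case (Suc m)
  have "laguerre (\<alpha> + 1) (Suc m) x = (\<Sum>k\<le>m. ((real (Suc m) + \<alpha> + 1) gchoose Suc (m - k)) * (- x) ^ k / fact k)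
      + (- x) ^ Suc m / fact (Suc m)"
    by (simp add: laguerre_def Suc_diff_le add_ac)
  also have "\<dots> = laguerre (\<alpha> + 1) m x + laguerre \<alpha> (Suc m) x"
    unfolding gbinomial_Suc_Suc
    by (simp add: laguerre_def Suc_diff_le distrib_right add_divide_distrib sum.distrib add_ac)
  finally show ?thesis by (simp add: laguerre'_def Suc)
qed (simp add: laguerre'_def)

text \<open>Multiplication by x shifts the power by one, and 1/k! = (k+1)/(k+1)! produces the factor
  \<open>real k\<close>, which also kills the new term at \<open>k = 0\<close>.\<close>

lemma laguerre_times_x:
  "x * laguerre \<alpha> n x = - (\<Sum>k\<le>Suc n. real k * ((real n + \<alpha>) gchoose (Suc n - k)) * (- x) ^ k / fact k)"
  by (subst sum.atMost_Suc_shift)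
    (auto simp: laguerre_def sum_distrib_left sum_negf[symmetric] simp del: of_nat_Suc intro!: sum.cong)

lemma laguerre'_times_x:
  "x * laguerre' \<alpha> n x = (\<Sum>k\<le>n. real k * ((real n + \<alpha>) gchoose (n - k)) * (- x) ^ k / fact k)"
  using laguerre_times_x[of x "\<alpha> + 1" "n - 1"] by (cases n) (simp_all add: laguerre'_def add_ac)

text \<open>Coefficientwise this is the absorption identity (a - i) binom(a, i) = a binom(a - 1, i)
  with a = n + \<alpha> and i = n - k.\<close>

lemma laguerre_lower:
  "x * laguerre' \<alpha> n x + \<alpha> * laguerre \<alpha> n x = (real n + \<alpha>) * laguerre (\<alpha> - 1) n x"
proof -
  have "x * laguerre' \<alpha> n x + \<alpha> * laguerre \<alpha> n x
      = (\<Sum>k\<le>n. (real k + \<alpha>) * ((real n + \<alpha>) gchoose (n - k)) * (- x) ^ k / fact k)"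
    unfolding laguerre'_times_x laguerre_def
    by (simp add: sum_distrib_left sum.distrib[symmetric] distrib_right add_divide_distrib mult.assoc)
  also have "\<dots> = (\<Sum>k\<le>n. (real n + \<alpha>) * ((real n + (\<alpha> - 1)) gchoose (n - k)) * (- x) ^ k / fact k)"
  proof (rule sum.cong[OF refl])
    fix k assume "k \<in> {..n}"
    then have "real n + \<alpha> - real (n - k) = real k + \<alpha>" by (simp add: of_nat_diff)
    then have "(real k + \<alpha>) * ((real n + \<alpha>) gchoose (n - k)) = (real n + \<alpha>) * ((real n + (\<alpha> - 1)) gchoose (n - k))"
      using gbinomial_absorb_comp[of "real n + \<alpha>" "n - k"]
      by (simp only: add_diff_eq)
    then show "(real k + \<alpha>) * ((real n + \<alpha>) gchoose (n - k)) * (- x) ^ k / fact k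
        = (real n + \<alpha>) * ((real n + (\<alpha> - 1)) gchoose (n - k)) * (- x) ^ k / fact k"
      by simp
  qed
  finally show ?thesis
    by (simp add: laguerre_def sum_distrib_left mult.assoc)
qed

text \<open>Inside the coefficient sum, n + 1 = (n + 1 - k) + k. Absorption turns the first part
  into (n + \<alpha>) times L_n with parameter \<alpha> - 1, to which \<open>laguerre_lower\<close>
  applies; the second part is -x times L_n with parameter \<alpha>.\<close>

lemma laguerre_raise:
  "x * laguerre' \<alpha> n x + (\<alpha> - x) * laguerre \<alpha> n x = (real n + 1) * laguerre (\<alpha> - 1) (Suc n) x"
proof -
  let ?t = "\<lambda>k. (- x) ^ k / fact k"
  have "(real n + 1) * laguerre (\<alpha> - 1) (Suc n) x
      = (\<Sum>k\<le>Suc n. real (Suc n - k) * ((real n + \<alpha>) gchoose (Suc n - k)) * ?t k)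
      + (\<Sum>k\<le>Suc n. real k * ((real n + \<alpha>) gchoose (Suc n - k)) * ?t k)"
    unfolding laguerre_def sum.distrib[symmetric] sum_distrib_left
    by (intro sum.cong) (auto simp: of_nat_diff algebra_simps add_divide_distrib)
  also have "(\<Sum>k\<le>Suc n. real (Suc n - k) * ((real n + \<alpha>) gchoose (Suc n - k)) * ?t k)
      = (\<Sum>k\<le>n. real (Suc (n - k)) * ((real n + \<alpha>) gchoose (Suc (n - k))) * ?t k)"
    by (simp add: Suc_diff_le del: of_nat_Suc of_nat_diff)
  also have "\<dots> = (real n + \<alpha>) * laguerre (\<alpha> - 1) n x"
    unfolding gbinomial_absorption by (simp add: laguerre_def sum_distrib_left mult.assoc add_diff_eq)
  also have "(\<Sum>k\<le>Suc n. real k * ((real n + \<alpha>) gchoose (Suc n - k)) * ?t k) = - (x * laguerre \<alpha> n x)"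
    by (subst laguerre_times_x) (simp add: mult.assoc)
  finally show ?thesis
    using laguerre_lower[of x \<alpha> n] by (simp add: algebra_simps)
qed

text \<open>
  In \<open>(a, b, k)\<close> the flags record the presence of the factors $e^x$ and $x^{-\alpha}$: the
  indices \<open>n\<close>, \<open>m\<close>, \<open>m'\<close>, \<open>n'\<close> carry the flags
  \<open>(False, False)\<close>, \<open>(True, False)\<close>, \<open>(False, True)\<close>, \<open>(True, True)\<close>.
\<close>

fun lag_fun :: "real \<Rightarrow> bool \<times> bool \<times> nat \<Rightarrow> real \<Rightarrow> real" where
  "lag_fun \<alpha> (a, b, k) y = (if a then exp y else 1) * (if b then y powr (- \<alpha>) else 1) *
     laguerre (if b then - \<alpha> else \<alpha>) k (if a then - y else y)"

text \<open>The index after division by the seed \<open>(a\<^sub>0, b\<^sub>0, 0)\<close> and one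
  differentiation. The truncation of \<open>k - 1\<close> at \<open>k = 0\<close> is harmless
  because \<open>lag_coeff\<close> is 0 there.\<close>

fun lag_up :: "bool \<Rightarrow> bool \<Rightarrow> bool \<times> bool \<times> nat \<Rightarrow> bool \<times> bool \<times> nat" where
  "lag_up a\<^sub>0 b\<^sub>0 (a, b, k) =
     (a, b, if a = a\<^sub>0 then (if b = b\<^sub>0 then k - 1 else k) else (if b = b\<^sub>0 then k else Suc k))"

fun lag_coeff :: "real \<Rightarrow> bool \<Rightarrow> bool \<Rightarrow> bool \<times> bool \<times> nat \<Rightarrow> real" where
  "lag_coeff \<alpha> a\<^sub>0 b\<^sub>0 (a, b, k) =
     (if a = a\<^sub>0 then (if b = b\<^sub>0 then (if k = 0 then 0 else if a then 1 else - 1) else real k + (if b then - \<alpha> else \<alpha>))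
      else (if b = b\<^sub>0 then (if a then 1 else - 1) else real k + 1))"

text \<open>One shape with parameters \<open>e\<close>, \<open>g\<close>, \<open>s\<close> covers
  all sixteen combinations of the flags of a function and of a seed.\<close>

lemma deriv_exp_powr_laguerre:
  fixes y :: real
  assumes "y > 0"
  shows "((\<lambda>y. exp (e * y) * y powr g * laguerre \<beta> k (s * y)) has_field_derivative
    exp (e * y) * y powr g / y * ((e * y + g) * laguerre \<beta> k (s * y) + s * y * laguerre' \<beta> k (s * y))) (at y)"
proof -
  have "((\<lambda>y. laguerre \<beta> k (s * y)) has_field_derivative laguerre' \<beta> k (s * y) * s) (at y)"
    using DERIV_chain2[OF has_field_derivative_laguerre, of "\<lambda>y. s * y" s y] by (auto intro!: derivative_eq_intros)
  moreover have "((\<lambda>y. y powr g) has_field_derivative g * (y powr g / y)) (at y)"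
    using has_real_derivative_powr[OF assms, of g] assms by (simp add: powr_diff)
  moreover have "((\<lambda>y. exp (e * y)) has_field_derivative exp (e * y) * e) (at y)"
    by (auto intro!: derivative_eq_intros)
  ultimately have "((\<lambda>y. exp (e * y) * y powr g * laguerre \<beta> k (s * y)) has_field_derivative
      (exp (e * y) * e * y powr g + g * (y powr g / y) * exp (e * y)) * laguerre \<beta> k (s * y)
      + laguerre' \<beta> k (s * y) * s * (exp (e * y) * y powr g)) (at y)"
    by (intro DERIV_mult)
  then show ?thesis
    using assms by (simp add: field_simps)
qed

text \<open>Each of the four ways in which the flags of \<open>p\<close> agree with those of the
  seed is settled by one contiguity relation. The prefactor does not depend on \<open>p\<close>, so
  it can later be pulled out of a Wronskian as a gauge factor.\<close>

lemma deriv_lag_fun_quotient: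
  assumes y: "y > 0"
  shows "((\<lambda>y. lag_fun \<alpha> p y / lag_fun \<alpha> (a\<^sub>0, b\<^sub>0, 0) y) has_field_derivative
    (if b\<^sub>0 then 1 / y else 1) / lag_fun \<alpha> (a\<^sub>0, b\<^sub>0, 0) y *
      (lag_coeff \<alpha> a\<^sub>0 b\<^sub>0 p * lag_fun (if b\<^sub>0 then \<alpha> - 1 else \<alpha> + 1) (lag_up a\<^sub>0 b\<^sub>0 p) y)) (at y)"
proof -
  obtain a b k where p: "p = (a, b, k)" by (cases p)
  define e :: real where "e = of_bool a - of_bool a\<^sub>0"
  define g where "g = (of_bool b\<^sub>0 - of_bool b) * \<alpha>"
  define \<beta> where "\<beta> = (if b then - \<alpha> else \<alpha>)"
  define s :: real where "s = (if a then - 1 else 1)"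
  have q: "exp (e * z) * z powr g * laguerre \<beta> k (s * z) = lag_fun \<alpha> p z / lag_fun \<alpha> (a\<^sub>0, b\<^sub>0, 0) z" if "z \<in> {0<..}" for z
    using that by (cases a; cases a\<^sub>0; cases b; cases b\<^sub>0)
      (simp_all add: p e_def g_def \<beta>_def s_def exp_minus powr_minus field_simps)
  \<comment> \<open>The parameter is \<alpha> or -\<alpha> according to the power flag. The change
    of \<alpha> therefore raises it for functions sharing that flag with the seed and lowers it for
    the others.\<close>
  define \<beta>' where "\<beta>' = (if b = b\<^sub>0 then \<beta> + 1 else \<beta> - 1)"
  define k' where "k' = snd (snd (lag_up a\<^sub>0 b\<^sub>0 p))"
  have r: "exp (e * y) * y powr g * (if b = b\<^sub>0 then 1 else 1 / y) * laguerre \<beta>' k' (s * y)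
      = (if b\<^sub>0 then 1 / y else 1) / lag_fun \<alpha> (a\<^sub>0, b\<^sub>0, 0) y *
        lag_fun (if b\<^sub>0 then \<alpha> - 1 else \<alpha> + 1) (lag_up a\<^sub>0 b\<^sub>0 p) y"
    using y by (cases a; cases a\<^sub>0; cases b; cases b\<^sub>0;
      simp add: p e_def g_def \<beta>_def \<beta>'_def s_def k'_def exp_minus powr_minus powr_diff powr_add field_simps;
      simp only: minus_diff_commute)
  have L2: "- (s * y) * laguerre \<beta> k (s * y) + s * y * laguerre' \<beta> k (s * y) = - (s * y * laguerre (\<beta> + 1) k (s * y))"
    using arg_cong[OF laguerre'_minus_laguerre[of \<beta> k "s * y"], of "\<lambda>z. s * y * z"] by (simp add: algebra_simps)
  have L3: "\<beta> * laguerre \<beta> k (s * y) + s * y * laguerre' \<beta> k (s * y) = (real k + \<beta>) * laguerre (\<beta> - 1) k (s * y)"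
    using laguerre_lower[of "s * y" \<beta> k] by simp
  have L4: "(- s * y + \<beta>) * laguerre \<beta> k (s * y) + s * y * laguerre' \<beta> k (s * y) = (real k + 1) * laguerre (\<beta> - 1) (Suc k) (s * y)"
    using laguerre_raise[of "s * y" \<beta> k] by (simp add: algebra_simps)
  \<comment> \<open>The factor \<open>y\<close> for equal power flags cancels the common
    \<open>1 / y\<close> of the derivative formula; for different flags the \<open>1 / y\<close> is
    absorbed by \<open>r\<close>.\<close>
  have "(e * y + g) * laguerre \<beta> k (s * y) + s * y * laguerre' \<beta> k (s * y)
      = lag_coeff \<alpha> a\<^sub>0 b\<^sub>0 p * ((if b = b\<^sub>0 then y else 1) * laguerre \<beta>' k' (s * y))"
  proof (cases "a = a\<^sub>0"; cases "b = b\<^sub>0")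
    assume "a = a\<^sub>0" "b = b\<^sub>0"
    then show ?thesis
      by (cases a) (auto simp: p e_def g_def \<beta>'_def k'_def s_def laguerre'_def split: nat.split)
  next
    assume "a \<noteq> a\<^sub>0" "b = b\<^sub>0"
    moreover from this have "e = - s" "g = 0" by (auto simp: e_def s_def g_def)
    ultimately show ?thesis
      using L2 by (cases a) (auto simp: p \<beta>'_def k'_def s_def)
  next
    assume "a = a\<^sub>0" "b \<noteq> b\<^sub>0"
    moreover from this have "e = 0" "g = \<beta>" by (auto simp: e_def s_def g_def \<beta>_def)
    ultimately show ?thesis
      using L3 by (auto simp: p \<beta>'_def k'_def \<beta>_def)
  next
    assume "a \<noteq> a\<^sub>0" "b \<noteq> b\<^sub>0"
    moreover from this have "e = - s" "g = \<beta>" by (auto simp: e_def s_def g_def \<beta>_def)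
    ultimately show ?thesis
      using L4 by (auto simp: p \<beta>'_def k'_def)
  qed
  then have "exp (e * y) * y powr g / y * ((e * y + g) * laguerre \<beta> k (s * y) + s * y * laguerre' \<beta> k (s * y)) =
      lag_coeff \<alpha> a\<^sub>0 b\<^sub>0 p * (exp (e * y) * y powr g * (if b = b\<^sub>0 then 1 else 1 / y) * laguerre \<beta>' k' (s * y))"
    using y by simp
  also note r
  finally have "exp (e * y) * y powr g / y * ((e * y + g) * laguerre \<beta> k (s * y) + s * y * laguerre' \<beta> k (s * y)) =
      (if b\<^sub>0 then 1 / y else 1) / lag_fun \<alpha> (a\<^sub>0, b\<^sub>0, 0) y *
      (lag_coeff \<alpha> a\<^sub>0 b\<^sub>0 p * lag_fun (if b\<^sub>0 then \<alpha> - 1 else \<alpha> + 1) (lag_up a\<^sub>0 b\<^sub>0 p) y)"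
    by (simp only: mult_ac)
  with deriv_exp_powr_laguerre[OF y, of e g \<beta> k s]
  have "((\<lambda>y. exp (e * y) * y powr g * laguerre \<beta> k (s * y)) has_field_derivative
      (if b\<^sub>0 then 1 / y else 1) / lag_fun \<alpha> (a\<^sub>0, b\<^sub>0, 0) y *
      (lag_coeff \<alpha> a\<^sub>0 b\<^sub>0 p * lag_fun (if b\<^sub>0 then \<alpha> - 1 else \<alpha> + 1) (lag_up a\<^sub>0 b\<^sub>0 p) y)) (at y)"
    by (simp only:)
  then show ?thesis
    by (rule has_field_derivative_transform_within_open[OF _ open_greaterThan _ q]) (use y in simp_all)
qed

section \<open>Smoothness of the four families and removal of a seed\<close>

lemma smooth_exp: "smooth_on S (\<lambda>y. exp (c * y))" if "open S"
proof (rule smooth_on_coinduct[OF that])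
  let ?F = "range (\<lambda>d y. d * exp (c * y))"
  show "(\<lambda>y. exp (c * y)) \<in> ?F" by (rule range_eqI[of _ _ 1]) simp
  fix f assume "f \<in> ?F"
  then obtain d where f: "f = (\<lambda>y. d * exp (c * y))" by blast
  show "\<exists>g\<in>?F. \<forall>y\<in>S. (f has_field_derivative g y) (at y)"
    unfolding f by (rule bexI[of _ "\<lambda>y. (d * c) * exp (c * y)"]) (auto intro!: derivative_eq_intros)
qed

lemma smooth_powr: "smooth_on {0<..} (\<lambda>y::real. y powr r)"
proof (rule smooth_on_coinduct[OF open_greaterThan])
  let ?F = "range (\<lambda>(d, r) (y::real). d * y powr r)"
  show "(\<lambda>y::real. y powr r) \<in> ?F" by (rule range_eqI[of _ _ "(1, r)"]) simp
  fix f assume "f \<in> ?F"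
  then obtain d r where f: "f = (\<lambda>y::real. d * y powr r)" by auto
  show "\<exists>g\<in>?F. \<forall>y\<in>{0<..}. (f has_field_derivative g y) (at y)"
    unfolding f
  proof (intro bexI[of _ "\<lambda>y. (d * r) * y powr (r - 1)"] ballI)
    show "(\<lambda>y::real. (d * r) * y powr (r - 1)) \<in> ?F" by (rule range_eqI[of _ _ "(d * r, r - 1)"]) simp
    fix y :: real assume "y \<in> {0<..}"
    then show "((\<lambda>y. d * y powr r) has_field_derivative d * r * y powr (r - 1)) (at y)"
      using DERIV_cmult[OF has_real_derivative_powr[of y r], of d] by (simp add: mult.assoc)
  qed
qed

lemma smooth_laguerre: "smooth_on S (\<lambda>y. laguerre \<alpha> k (s * y))" if "open S"
proof (rule smooth_on_coinduct[OF that])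
  let ?F = "range (\<lambda>(d, \<alpha>, k) y. d * laguerre \<alpha> k (s * y))"
  show "(\<lambda>y. laguerre \<alpha> k (s * y)) \<in> ?F" by (rule range_eqI[of _ _ "(1, \<alpha>, k)"]) simp
  fix f assume "f \<in> ?F"
  then obtain d \<alpha> k where f: "f = (\<lambda>y. d * laguerre \<alpha> k (s * y))" by auto
  have D: "((\<lambda>y. d * laguerre \<alpha> k (s * y)) has_field_derivative d * (laguerre' \<alpha> k (s * y) * s)) (at y)" for y
    by (intro DERIV_cmult DERIV_chain2[OF has_field_derivative_laguerre]) (auto intro!: derivative_eq_intros)
  have "(\<lambda>y. d * (laguerre' \<alpha> k (s * y) * s)) \<in> ?F"
  proof (cases k)
    case 0
    \<comment> \<open>The zero function belongs to the family because the multiplier may be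
      0.\<close>
    then show ?thesis by (intro range_eqI[of _ _ "(0, 0, 0)"]) (simp add: laguerre'_def)
  next
    case (Suc m)
    then show ?thesis by (intro range_eqI[of _ _ "(- d * s, \<alpha> + 1, m)"]) (auto simp: laguerre'_def)
  qed
  with D show "\<exists>g\<in>?F. \<forall>y\<in>S. (f has_field_derivative g y) (at y)"
    unfolding f by (intro bexI[of _ "\<lambda>y. d * (laguerre' \<alpha> k (s * y) * s)"]) auto
qed

lemma smooth_exp_powr_laguerre: "smooth_on {0<..} (\<lambda>y. exp (c * y) * y powr r * laguerre \<alpha> k (s * y))"
  by (intro smooth_on_mult open_greaterThan smooth_exp smooth_powr smooth_laguerre)

lemma smooth_lag_fun: "smooth_on {0<..} (lag_fun \<alpha> p)"
proof -
  obtain a b k where p: "p = (a, b, k)" by (cases p)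
  show ?thesis
    by (rule smooth_on_cong[OF open_greaterThan _
          smooth_exp_powr_laguerre[of "of_bool a" "of_bool b * (- \<alpha>)" "if b then - \<alpha> else \<alpha>" k "if a then - 1 else 1"]])
      (auto simp: p)
qed

lemma lag_fun_0_pos: "y > 0 \<Longrightarrow> lag_fun \<alpha> (a, b, 0) y > 0"
  by simp

text \<open>Gauge by the seed, delete the resulting constant 1, gauge by the common prefactor of the
  derivatives and extract the constants. The powers of the seed cancel except for one, since the
  second Wronskian has one function fewer.\<close>

lemma wronskian_lag_fun_remove:
  fixes a\<^sub>0 b\<^sub>0 :: bool and \<alpha> :: real
  defines "\<alpha>' \<equiv> if b\<^sub>0 then \<alpha> - 1 else \<alpha> + 1"
  assumes x: "x > 0"
  shows "wronskian (map (lag_fun \<alpha>) (ps @ (a\<^sub>0, b\<^sub>0, 0) # qs)) x =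
    (- 1) ^ length ps * lag_fun \<alpha> (a\<^sub>0, b\<^sub>0, 0) x * (if b\<^sub>0 then 1 / x else 1) ^ length (ps @ qs) *
    prod_list (map (lag_coeff \<alpha> a\<^sub>0 b\<^sub>0) (ps @ qs)) *
    wronskian (map (lag_fun \<alpha>' \<circ> lag_up a\<^sub>0 b\<^sub>0) (ps @ qs)) x"
proof -
  note S = open_greaterThan[of "0 :: real"]
  from x have xS: "x \<in> {0<..}" by simp
  let ?\<phi> = "lag_fun \<alpha> (a\<^sub>0, b\<^sub>0, 0)"
  let ?c = "lag_coeff \<alpha> a\<^sub>0 b\<^sub>0"
  let ?g = "lag_fun \<alpha>' \<circ> lag_up a\<^sub>0 b\<^sub>0"
  let ?h = "\<lambda>y. (if b\<^sub>0 then 1 / y else 1) / ?\<phi> y"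
  let ?u = "\<lambda>p y. lag_fun \<alpha> p y / ?\<phi> y"
  let ?l = "ps @ (a\<^sub>0, b\<^sub>0, 0) # qs" and ?r = "ps @ qs"
  have \<phi>: "?\<phi> y \<noteq> 0" if "y \<in> {0<..}" for y
    using lag_fun_0_pos[of y \<alpha> a\<^sub>0 b\<^sub>0] that by (metis greaterThan_iff less_irrefl)
  \<comment> \<open>Index 0 makes the Laguerre factor 1, so the reciprocal of the seed also has the
    shape of \<open>smooth_exp_powr_laguerre\<close>.\<close>
  have sm_inv: "smooth_on {0<..} (\<lambda>y. 1 / ?\<phi> y)"
    by (rule smooth_on_cong[OF S _ smooth_exp_powr_laguerre[of "- of_bool a\<^sub>0" "of_bool b\<^sub>0 * \<alpha>" 0 0 0]])
      (auto simp: exp_minus powr_minus field_simps)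
  have sm_h: "smooth_on {0<..} ?h"
    by (rule smooth_on_cong[OF S _ smooth_exp_powr_laguerre[of "- of_bool a\<^sub>0" "of_bool b\<^sub>0 * (\<alpha> - 1)" 0 0 0]])
      (auto simp: exp_minus powr_minus powr_diff field_simps)
  have sm_u: "smooth_on {0<..} (?u p)" for p
    using smooth_on_mult[OF S smooth_lag_fun sm_inv, of \<alpha> p] by simp
  have "wronskian (map (lag_fun \<alpha>) ?l) x = wronskian (map (\<lambda>f y. ?\<phi> y * f y) (map ?u ?l)) x"
    by (rule wronskian_cong[OF S xS]) (use \<phi> in \<open>auto simp del: lag_fun.simps map_append\<close>)
  also have "\<dots> = ?\<phi> x ^ length (map ?u ?l) * wronskian (map ?u ?l) x"
    by (rule wronskian_gauge[OF S xS smooth_lag_fun]) (use sm_u in \<open>unfold set_map, blast\<close>)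
  also have "wronskian (map ?u ?l) x = wronskian (map ?u ps @ (\<lambda>_. 1) # map ?u qs) x"
    by (rule wronskian_cong[OF S xS]) (use \<phi> in \<open>auto simp: nth_append nth_Cons simp del: lag_fun.simps split: nat.split\<close>)
  also have "\<dots> = (- 1) ^ length ps * wronskian (map deriv (map ?u ?r)) x"
    by (subst wronskian_remove_one) simp
  also have "wronskian (map deriv (map ?u ?r)) x = wronskian (map (\<lambda>f y. ?h y * f y) (map (\<lambda>p y. ?c p * ?g p y) ?r)) x"
  proof (rule wronskian_cong[OF S xS], goal_cases)
    case (2 i y)
    then show ?case
      using DERIV_imp_deriv[OF deriv_lag_fun_quotient[of y \<alpha> "?r ! i" a\<^sub>0 b\<^sub>0]]
      by (simp add: \<alpha>'_def del: lag_fun.simps map_append)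
  qed simp
  also have "\<dots> = ?h x ^ length ?r * wronskian (map (\<lambda>p y. ?c p * ?g p y) ?r) x"
  proof (subst wronskian_gauge[OF S xS sm_h], goal_cases)
    case (1 f)
    then obtain p where f: "f = (\<lambda>y. ?c p * ?g p y)" by auto
    have "smooth_on {0<..} (\<lambda>y. exp (0 * y) * ?c p)"
      by (rule smooth_on_coinduct[OF S, of _ "range (\<lambda>c _. c)"]) (auto intro!: derivative_eq_intros)
    from smooth_on_mult[OF S this smooth_lag_fun] show ?case by (simp add: f)
  qed simp
  also have "wronskian (map (\<lambda>p y. ?c p * ?g p y) ?r) x = prod_list (map ?c ?r) * wronskian (map ?g ?r) x"
    by (rule wronskian_map_cmult[OF S xS]) (simp add: smooth_lag_fun)
  finally show ?thesis
    using \<phi>[OF xS] by (simp add: power_divide field_simps del: lag_fun.simps)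
qed

section \<open>Continuity in the parameter\<close>

lemma deriv_lag_fun:
  assumes "y > 0"
  shows "(lag_fun \<alpha> p has_field_derivative
    lag_coeff \<alpha> False False p * lag_fun (\<alpha> + 1) (lag_up False False p) y) (at y)"
  \<comment> \<open>The seed \<open>(False, False, 0)\<close> is the constant 1, so the quotient is
    the function itself.\<close>
  using deriv_lag_fun_quotient[OF assms, of \<alpha> p False False]
  by (cases p) (simp del: lag_fun.simps(1) add: lag_fun.simps(1)[of _ False False 0])

lemma isCont_gbinomial: "isCont (\<lambda>\<alpha> :: real. f \<alpha> gchoose k) \<alpha>\<^sub>0" if "isCont f \<alpha>\<^sub>0" for f :: "real \<Rightarrow> real"
  unfolding gbinomial_prod_rev using that by (intro continuous_intros) auto

text \<open>An x-derivative of a member is an explicit coefficient times a member with parameter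
  larger by 1. The induction therefore ranges over all shifts \<open>c\<close> and all triples
  \<open>p\<close>.\<close>

lemma isCont_higher_deriv_lag_fun:
  assumes x: "x > 0"
  shows "isCont (\<lambda>\<alpha>. (deriv ^^ j) (lag_fun (\<alpha> + c) p) x) \<alpha>\<^sub>0"
proof (induction j arbitrary: p c)
  case 0
  obtain a b k where p: "p = (a, b, k)" by (cases p)
  show ?case
    using x by (cases b)
      (auto simp: p laguerre_def intro!: continuous_intros isCont_gbinomial)
next
  case (Suc j)
  have "(deriv ^^ Suc j) (lag_fun (\<alpha> + c) p) x =
      lag_coeff (\<alpha> + c) False False p * (deriv ^^ j) (lag_fun (\<alpha> + (c + 1)) (lag_up False False p)) x" for \<alpha>
  proof -
    have "(deriv ^^ Suc j) (lag_fun (\<alpha> + c) p) x = (deriv ^^ j) (deriv (lag_fun (\<alpha> + c) p)) x"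
      by (simp add: funpow_swap1)
    also have "\<dots> = (deriv ^^ j) (\<lambda>y. lag_coeff (\<alpha> + c) False False p * lag_fun (\<alpha> + c + 1) (lag_up False False p) y) x"
      by (rule higher_deriv_cong_open[of "{0<..}"]) (use x in \<open>auto intro!: DERIV_imp_deriv deriv_lag_fun simp del: lag_fun.simps\<close>)
    also have "\<dots> = lag_coeff (\<alpha> + c) False False p * (deriv ^^ j) (lag_fun (\<alpha> + c + 1) (lag_up False False p)) x"
      by (rule higher_deriv_cmult_real[of "{0<..}"]) (use x in \<open>auto intro: smooth_lag_fun simp del: lag_fun.simps\<close>)
    finally show ?thesis by (simp add: add.assoc)
  qed
  moreover have "isCont (\<lambda>\<alpha>. lag_coeff (\<alpha> + c) False False p) \<alpha>\<^sub>0"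
  proof -
    obtain a b k where p: "p = (a, b, k)" by (cases p)
    show ?thesis
      by (cases a; cases b; cases k) (auto simp: p intro!: continuous_intros)
  qed
  ultimately show ?case
    using Suc by (auto intro!: continuous_mult)
qed

lemma isCont_wronskian_lag_fun:
  assumes "x > 0"
  shows "isCont (\<lambda>\<alpha>. wronskian (map (lag_fun (\<alpha> + c)) ps) x) \<alpha>\<^sub>0"
proof -
  let ?n = "length ps"
  have "wronskian (map (lag_fun (\<alpha> + c)) ps) x =
      (\<Sum>\<pi> | \<pi> permutes {0..<?n}. signof \<pi> * (\<Prod>i = 0..<?n. (deriv ^^ \<pi> i) (lag_fun (\<alpha> + c) (ps ! i)) x))" for \<alpha>
    unfolding wronskian_def det_def
    by (auto simp: permutes_def intro!: sum.cong prod.cong)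
  then show ?thesis
    by (simp only:) (intro continuous_intros isCont_higher_deriv_lag_fun assms)
qed

text \<open>The integers have no limit point, so a punctured neighbourhood of \<open>a\<close>
  avoids them and both functions have the same limit there.\<close>

lemma eq_if_eq_off_Ints:
  fixes f g :: "real \<Rightarrow> real"
  assumes "isCont f a" "isCont g a" and eq: "\<And>\<alpha>. \<alpha> \<notin> \<int> \<Longrightarrow> f \<alpha> = g \<alpha>"
  shows "f a = g a"
proof -
  have "\<not> a islimpt \<int>"
    by (rule discrete_imp_not_islimpt[of 1]) (auto simp: dist_of_int elim!: Ints_cases)
  then have "\<forall>\<^sub>F \<alpha> in at a. \<alpha> \<notin> \<int>"
    by (simp add: islimpt_conv_frequently_at frequently_def)
  then have "\<forall>\<^sub>F \<alpha> in at a. f \<alpha> = g \<alpha>"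
    by (rule eventually_mono) (rule eq)
  with assms(1) have "(g \<longlongrightarrow> f a) (at a)"
    unfolding isCont_def by (rule tendsto_cong[THEN iffD1, rotated])
  with assms(2) show ?thesis
    unfolding isCont_def by (intro LIM_unique)
qed

section \<open>The four removal steps\<close>

definition lag_list :: "nat list \<Rightarrow> nat list \<Rightarrow> nat list \<Rightarrow> nat list \<Rightarrow> (bool \<times> bool \<times> nat) list" where
  "lag_list n m m' n' = map (\<lambda>k. (False, False, k)) n @ map (\<lambda>k. (True, False, k)) m @
     map (\<lambda>k. (False, True, k)) m' @ map (\<lambda>k. (True, True, k)) n'"

definition lag_wronskian :: "real \<Rightarrow> nat list \<Rightarrow> nat list \<Rightarrow> nat list \<Rightarrow> nat list \<Rightarrow> real \<Rightarrow> real" where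
  "lag_wronskian \<alpha> n m m' n' x = exp (- real (length m + length n') * x) *
     x powr ((\<alpha> + real (length n) + real (length m)) * (real (length m') + real (length n'))) *
     wronskian (map (lag_fun \<alpha>) (lag_list n m m' n')) x"

lemma prod_list_map_const: "prod_list (map (\<lambda>_. c) xs) = (c :: real) ^ length xs"
  by (induction xs) auto

text \<open>No sign remains: the seed at position \<open>length n\<close> and the coefficients -1 of
  the \<open>length n\<close> functions before it cancel. The exponent of x is unchanged, as
  \<alpha> grows by 1 while the first list loses an entry.\<close>

lemma lag_wronskian_remove_n:
  assumes x: "x > 0"
  shows "lag_wronskian \<alpha> (map Suc n @ [0]) m m' n' x =
    (\<Prod>k\<leftarrow>m'. real k - \<alpha>) * (\<Prod>k\<leftarrow>n'. real k + 1) * lag_wronskian (\<alpha> + 1) n m m' (map Suc n') x"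
proof -
  let ?q = "map (\<lambda>k. (True, False, k)) m @ map (\<lambda>k. (False, True, k)) m' @ map (\<lambda>k. (True, True, k)) n'"
  have "wronskian (map (lag_fun \<alpha>) (lag_list (map Suc n @ [0]) m m' n')) x =
      (\<Prod>k\<leftarrow>m'. real k - \<alpha>) * (\<Prod>k\<leftarrow>n'. real k + 1) *
      wronskian (map (lag_fun (\<alpha> + 1)) (lag_list n m m' (map Suc n'))) x"
    using wronskian_lag_fun_remove[OF x, of \<alpha> "map (\<lambda>k. (False, False, k)) (map Suc n)" False False ?q]
    by (simp add: lag_list_def o_def prod_list_map_const power_mult_distrib[symmetric] del: lag_fun.simps(1)
        add: lag_fun.simps(1)[of _ False False 0])
  then show ?thesis
    by (simp add: lag_wronskian_def add_ac)
qed

text \<open>Removing a seed with a power factor yields that factor and one \<open>1 / x\<close> for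
  each of the \<open>N\<close> remaining functions. Together they account for lowering both \<alpha>
  and the number of power-type functions by 1.\<close>

lemma powr_gauge:
  fixes x :: real
  assumes "x > 0" and N: "R + real S = real N"
  shows "x powr ((\<alpha> + R) * (real S + 1)) * (x powr (- \<alpha>) * (1 / x) ^ N) = x powr ((\<alpha> - 1 + R) * real S)"
proof -
  have "(1 / x) ^ N = x powr (- real N)"
    using assms by (simp add: powr_minus powr_realpow power_one_over field_simps)
  then show ?thesis
    using N[symmetric] by (simp flip: powr_add) (simp add: algebra_simps)
qed

lemma exp_gauge: "exp (- real (Suc k) * x) * exp x = exp (- real k * x :: real)"
  unfolding exp_add[symmetric] by (simp add: algebra_simps)

lemma gauge_rearrange:
  fixes A A' P P' E X c w :: real
  assumes "A * E = A'" "P * X = P'"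
  shows "A * P * (E * X * (c * w)) = c * (A' * P' * w)"
  by (simp flip: assms)

text \<open>The seed has position \<open>length n + length m\<close>; the coefficients -1 of the
  \<open>n\<close> functions leave the sign of \<open>length m\<close>.\<close>

lemma lag_wronskian_remove_m:
  assumes x: "x > 0"
  shows "lag_wronskian \<alpha> n (map Suc m @ [0]) m' n' x =
    (- 1) ^ length m * (\<Prod>k\<leftarrow>m'. real k + 1) * (\<Prod>k\<leftarrow>n'. real k - \<alpha>) *
    lag_wronskian (\<alpha> + 1) n m (map Suc m') n' x"
proof -
  let ?p = "map (\<lambda>k. (False, False, k)) n @ map (\<lambda>k. (True, False, k)) (map Suc m)"
  let ?q = "map (\<lambda>k. (False, True, k)) m' @ map (\<lambda>k. (True, True, k)) n'"
  have *: "wronskian (map (lag_fun \<alpha>) (lag_list n (map Suc m @ [0]) m' n')) x =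
      exp x * 1 * ((- 1) ^ length m * (\<Prod>k\<leftarrow>m'. real k + 1) * (\<Prod>k\<leftarrow>n'. real k - \<alpha>) *
      wronskian (map (lag_fun (\<alpha> + 1)) (lag_list n m (map Suc m') n')) x)"
    using wronskian_lag_fun_remove[OF x, of \<alpha> ?p True False ?q]
    by (simp add: lag_list_def o_def prod_list_map_const power_add power_mult_distrib[symmetric] del: lag_fun.simps(1)
        add: lag_fun.simps(1)[of _ True False 0])
  show ?thesis
    unfolding lag_wronskian_def *
    using exp_gauge[of "length m + length n'" x] by (intro gauge_rearrange) (simp_all add: algebra_simps)
qed

lemma lag_wronskian_remove_m':
  assumes x: "x > 0"
  shows "lag_wronskian \<alpha> n m (map Suc m' @ [0]) n' x =
    (- 1) ^ (length n + length m) * (\<Prod>k\<leftarrow>n. real k + \<alpha>) * (\<Prod>k\<leftarrow>m. real k + 1) *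
    lag_wronskian (\<alpha> - 1) n (map Suc m) m' n' x"
proof -
  let ?p = "map (\<lambda>k. (False, False, k)) n @ map (\<lambda>k. (True, False, k)) m @ map (\<lambda>k. (False, True, k)) (map Suc m')"
  let ?q = "map (\<lambda>k. (True, True, k)) n'"
  let ?N = "length n + length m + (length m' + length n')"
  have *: "wronskian (map (lag_fun \<alpha>) (lag_list n m (map Suc m' @ [0]) n')) x =
      1 * (x powr (- \<alpha>) * (1 / x) ^ ?N) * ((- 1) ^ (length n + length m) * (\<Prod>k\<leftarrow>n. real k + \<alpha>) * (\<Prod>k\<leftarrow>m. real k + 1) *
      wronskian (map (lag_fun (\<alpha> - 1)) (lag_list n (map Suc m) m' n')) x)"
    using wronskian_lag_fun_remove[OF x, of \<alpha> ?p False True ?q]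
    by (simp add: lag_list_def o_def prod_list_map_const power_add power_mult_distrib[symmetric] del: lag_fun.simps(1)
        add: lag_fun.simps(1)[of _ False True 0])
  show ?thesis
    unfolding lag_wronskian_def *
    using powr_gauge[OF x, of "real (length n) + real (length m)" "length m' + length n'" ?N \<alpha>]
    by (intro gauge_rearrange) (simp_all add: add_ac)
qed

text \<open>The seed is last, and the coefficients -1 of the \<open>m'\<close> functions cancel
  their share of its position sign.\<close>

lemma lag_wronskian_remove_n':
  assumes x: "x > 0"
  shows "lag_wronskian \<alpha> n m m' (map Suc n' @ [0]) x =
    (- 1) ^ (length n + length m + length n') * (\<Prod>k\<leftarrow>n. real k + 1) * (\<Prod>k\<leftarrow>m. real k + \<alpha>) *
    lag_wronskian (\<alpha> - 1) (map Suc n) m m' n' x"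
proof -
  let ?p = "lag_list n m m' (map Suc n')"
  let ?N = "length n + length m + (length m' + length n')"
  have *: "wronskian (map (lag_fun \<alpha>) (lag_list n m m' (map Suc n' @ [0]))) x =
      exp x * (x powr (- \<alpha>) * (1 / x) ^ ?N) * ((- 1) ^ (length n + length m + length n') *
      (\<Prod>k\<leftarrow>n. real k + 1) * (\<Prod>k\<leftarrow>m. real k + \<alpha>) *
      wronskian (map (lag_fun (\<alpha> - 1)) (lag_list (map Suc n) m m' n')) x)"
    using wronskian_lag_fun_remove[OF x, of \<alpha> ?p True True "[]"]
    by (simp add: lag_list_def o_def prod_list_map_const power_add power_mult_distrib[symmetric] del: lag_fun.simps(1)
        add: lag_fun.simps(1)[of _ True True 0])
  show ?thesis
    unfolding lag_wronskian_def *
    using powr_gauge[OF x, of "real (length n) + real (length m)" "length m' + length n'" ?N \<alpha>]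
      exp_gauge[of "length m + length n'" x]
    by (intro gauge_rearrange) (simp_all add: add_ac)
qed

section \<open>Shifts of Maya diagrams\<close>

lemma mem_maya_shift: "k \<in> maya_shift M t \<longleftrightarrow> k - t \<in> M"
  unfolding maya_shift_def by (force intro: rev_image_eqI)

lemma mem_maya_of: "k \<in> maya_of n' n \<longleftrightarrow> (if k \<ge> 0 then nat k \<in> set n else nat (- k - 1) \<notin> set n')"
  by (auto simp: maya_of_def image_iff) (metis nat_0_le)

lemma maya_shift_shift: "maya_shift (maya_shift M s) t = maya_shift M (s + t)"
  by (auto simp: mem_maya_shift diff_diff_eq2 algebra_simps)

lemma maya_t_shift:
  assumes "maya_diagram M"
  shows "maya_t (maya_shift M s) = maya_t M - s"
  unfolding maya_t_def[of "maya_shift M s"] maya_shift_shift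
proof (rule the_equality)
  let ?P = "\<lambda>t. {..<0} \<subseteq> maya_shift M t \<and> 0 \<notin> maya_shift M t"
  have P: "?P (maya_t M)"
    unfolding maya_t_def by (rule theI') (rule maya_t_unique[OF assms])
  then show "?P (s + (maya_t M - s))" by simp
  show "t = maya_t M - s" if "?P (s + t)" for t
    using maya_t_unique[OF assms] P that by (metis add_diff_cancel_left')
qed

lemma maya_partition_shift:
  assumes "maya_diagram M"
  shows "maya_partition (maya_shift M s) = maya_partition M"
  unfolding maya_partition_def maya_t_shift[OF assms] maya_shift_shift by simp

text \<open>That 0 lies in the diagram becomes, one place lower, that -1 does: there is no hole of
  index 0, as in \<open>map Suc n'\<close>.\<close>

lemma maya_of_Suc_left: "maya_of n' (map Suc n @ [0]) = maya_shift (maya_of (map Suc n') n) 1"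
proof (rule Set.set_eqI)
  fix k :: int
  consider "k > 0" | "k = 0" | "k < 0" by linarith
  then show "k \<in> maya_of n' (map Suc n @ [0]) \<longleftrightarrow> k \<in> maya_shift (maya_of (map Suc n') n) 1"
  proof cases
    case 1
    then have "nat k = Suc (nat (k - 1))" by simp
    with 1 show ?thesis by (auto simp: mem_maya_of mem_maya_shift)
  next
    case 3
    then have "nat (- (k - 1) - 1) = Suc (nat (- k - 1))" by simp
    with 3 show ?thesis by (auto simp: mem_maya_of mem_maya_shift)
  qed (auto simp: mem_maya_of mem_maya_shift)
qed

text \<open>A hole of index 0 means that -1 is missing; one place higher, 0 is missing, as in
  \<open>map Suc n\<close>.\<close>

lemma maya_of_Suc_right: "maya_of n' (map Suc n) = maya_shift (maya_of (map Suc n' @ [0]) n) 1"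
proof (rule Set.set_eqI)
  fix k :: int
  consider "k > 0" | "k = 0" | "k < 0" by linarith
  then show "k \<in> maya_of n' (map Suc n) \<longleftrightarrow> k \<in> maya_shift (maya_of (map Suc n' @ [0]) n) 1"
  proof cases
    case 1
    then have "nat k = Suc (nat (k - 1))" by simp
    with 1 show ?thesis by (auto simp: mem_maya_of mem_maya_shift)
  next
    case 3
    then have "nat (- (k - 1) - 1) = Suc (nat (- k - 1))" by simp
    with 3 show ?thesis by (auto simp: mem_maya_of mem_maya_shift)
  qed (auto simp: mem_maya_of mem_maya_shift)
qed

section \<open>Signs, triangular numbers and the constant\<close>

definition alt :: "int \<Rightarrow> real" where
  "alt e = (if even e then 1 else - 1)"

lemma alt_add: "alt (a + b) = alt a * alt b"
  by (auto simp: alt_def)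

lemma alt_of_nat: "(- 1) ^ k = alt (int k)"
  by (auto simp: alt_def)

lemma alt_cong: "even (a - b) \<Longrightarrow> alt a = alt b"
  by (auto simp: alt_def)

lemma alt_self: "alt a * alt a = 1"
  by (auto simp: alt_def)

text \<open>The exponent in the theorem is an integer without a sign condition; only its parity
  matters.\<close>

lemma alt_powi: "(- 1) powi e = alt e"
proof (cases "e \<ge> 0")
  case True
  then show ?thesis by (auto simp: alt_def power_int_def even_nat_iff)
next
  case False
  then have "even (nat (- e)) \<longleftrightarrow> even e" by (simp add: even_nat_iff)
  with False show ?thesis by (auto simp: alt_def power_int_def)
qed

text \<open>The binomial coefficient (c choose 2), extended to all integers; the division is
  exact.\<close>

definition tri :: "int \<Rightarrow> int" where
  "tri c = c * (c - 1) div 2"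

lemma two_tri: "2 * tri c = c * (c - 1)"
  unfolding tri_def by simp

lemma tri_add: "tri (a + b) = tri a + tri b + a * b"
proof -
  have "2 * tri (a + b) = 2 * (tri a + tri b + a * b)"
    unfolding distrib_left two_tri by (simp add: algebra_simps)
  then show ?thesis by simp
qed

lemma tri_Suc: "tri (c + 1) = tri c + c"
  using tri_add[of c 1] by (simp add: tri_def)

definition prod_pairs :: "('a \<Rightarrow> 'b \<Rightarrow> real) \<Rightarrow> 'a list \<Rightarrow> 'b list \<Rightarrow> real" where
  "prod_pairs f xs ys = (\<Prod>x\<leftarrow>xs. \<Prod>y\<leftarrow>ys. f x y)"

lemma prod_pairs_snoc_left: "prod_pairs f (xs @ [a]) ys = prod_pairs f xs ys * (\<Prod>y\<leftarrow>ys. f a y)"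
  by (simp add: prod_pairs_def)

lemma prod_pairs_snoc_right: "prod_pairs f xs (ys @ [b]) = prod_pairs f xs ys * (\<Prod>x\<leftarrow>xs. f x b)"
  by (induction xs) (simp_all add: prod_pairs_def)

lemma prod_pairs_map_left: "prod_pairs f (map g xs) ys = prod_pairs (\<lambda>x. f (g x)) xs ys"
  by (simp add: prod_pairs_def o_def)

lemma prod_pairs_map_right: "prod_pairs f xs (map g ys) = prod_pairs (\<lambda>x y. f x (g y)) xs ys"
  by (simp add: prod_pairs_def o_def)

lemma prod_pairs_Nil_right: "prod_pairs f xs [] = 1"
  by (simp add: prod_pairs_def prod_list_map_const)

lemmas prod_pairs_simps = prod_pairs_snoc_left prod_pairs_snoc_right prod_pairs_map_left prod_pairs_map_right

text \<open>
  Closed form of the sign up to the term \<open>tri (length mu)\<close>, which is invariant under shifts and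
  is therefore kept in \<open>maya_omega\<close> below.
\<close>

definition maya_sign :: "nat list \<Rightarrow> nat list \<Rightarrow> nat list \<Rightarrow> nat list \<Rightarrow> int" where
  "maya_sign n m m' n' = int (length n) * int (length n') + (\<Sum>k\<leftarrow>n'. int k)
     + tri (int (length m) - int (length m')) + (\<Sum>k\<leftarrow>m'. int k) + int (length m')"

definition maya_const :: "real \<Rightarrow> nat list \<Rightarrow> nat list \<Rightarrow> nat list \<Rightarrow> nat list \<Rightarrow> real" where
  "maya_const \<alpha> n m m' n' = alt (maya_sign n m m' n')
     * prod_pairs (\<lambda>a b. real b - \<alpha> - real a) n m' * prod_pairs (\<lambda>a b. real b - \<alpha> - real a) m n'
     * prod_pairs (\<lambda>a b. real a + real b + 1) n n' * prod_pairs (\<lambda>a b. real a + real b + 1) m m'"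

lemma sum_list_Suc: "(\<Sum>k\<leftarrow>xs. 1 + int k) = sum_list (map int xs) + int (length xs)"
  by (induction xs) auto

lemma prod_list_reflect: "(\<Prod>k\<leftarrow>xs. - \<alpha> - real k) = (- 1) ^ length xs * (\<Prod>k\<leftarrow>xs. real k + \<alpha>)"
  by (induction xs) (auto simp: algebra_simps)

text \<open>The factors are those of \<open>lag_wronskian_remove_n\<close>. In the sign, the
  additional \<open>length n'\<close> from the longer first list equals the growth of the sum over
  \<open>map Suc n'\<close>.\<close>

lemma maya_const_remove_n:
  "maya_const \<alpha> (map Suc n @ [0]) m m' n' =
    (\<Prod>k\<leftarrow>m'. real k - \<alpha>) * (\<Prod>k\<leftarrow>n'. real k + 1) * maya_const (\<alpha> + 1) n m m' (map Suc n')"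
proof -
  have sign: "maya_sign (map Suc n @ [0]) m m' n' = maya_sign n m m' (map Suc n')"
    by (simp add: maya_sign_def o_def sum_list_Suc algebra_simps)
  show ?thesis
    unfolding maya_const_def sign
    by (simp add: prod_pairs_simps algebra_simps)
qed

lemma maya_const_remove_m:
  "maya_const \<alpha> n (map Suc m @ [0]) m' n' =
    (- 1) ^ length m * (\<Prod>k\<leftarrow>m'. real k + 1) * (\<Prod>k\<leftarrow>n'. real k - \<alpha>) * maya_const (\<alpha> + 1) n m (map Suc m') n'"
proof -
  have sign: "alt (maya_sign n (map Suc m @ [0]) m' n') = (- 1) ^ length m * alt (maya_sign n m (map Suc m') n')"
    unfolding alt_of_nat alt_add[symmetric]
    using tri_Suc[of "int (length m) - int (length m')"]
    by (intro alt_cong) (simp add: maya_sign_def o_def sum_list_Suc algebra_simps)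
  show ?thesis
    unfolding maya_const_def sign
    by (simp add: prod_pairs_simps algebra_simps)
qed

lemma maya_const_remove_n':
  "maya_const \<alpha> n m m' (map Suc n' @ [0]) =
    (- 1) ^ (length n + length m + length n') * (\<Prod>k\<leftarrow>n. real k + 1) * (\<Prod>k\<leftarrow>m. real k + \<alpha>) *
    maya_const (\<alpha> - 1) (map Suc n) m m' n'"
proof -
  \<comment> \<open>The remaining sign of \<open>length m\<close> comes from the factors -\<alpha> -
    k over \<open>m\<close>, turned into k + \<alpha> by \<open>prod_list_reflect\<close>.\<close>
  have sign: "alt (maya_sign n m m' (map Suc n' @ [0])) = (- 1) ^ (length n + length n') * alt (maya_sign (map Suc n) m m' n')"
    unfolding alt_of_nat alt_add[symmetric]
    by (intro alt_cong) (simp add: maya_sign_def o_def sum_list_Suc algebra_simps)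
  show ?thesis
    unfolding maya_const_def sign
    by (simp add: prod_pairs_simps prod_list_reflect algebra_simps power_add)
qed

lemma maya_const_remove_m':
  "maya_const \<alpha> n m (map Suc m' @ [0]) n' =
    (- 1) ^ (length n + length m) * (\<Prod>k\<leftarrow>n. real k + \<alpha>) * (\<Prod>k\<leftarrow>m. real k + 1) *
    maya_const (\<alpha> - 1) n (map Suc m) m' n'"
proof -
  \<comment> \<open>Here the reflected factors run over \<open>n\<close> and supply the sign of
    \<open>length n\<close>.\<close>
  have sign: "alt (maya_sign n m (map Suc m' @ [0]) n') = (- 1) ^ length m * alt (maya_sign n (map Suc m) m' n')"
    unfolding alt_of_nat alt_add[symmetric]
    using arg_cong[OF tri_Suc[of "int (length m) - int (length m') - 1"], of even]
    by (intro alt_cong) (auto simp add: maya_sign_def o_def sum_list_Suc algebra_simps)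
  show ?thesis
    unfolding maya_const_def sign
    by (simp add: prod_pairs_simps prod_list_reflect algebra_simps power_add)
qed

section \<open>Propagation of the identity\<close>

lemma sorted_Suc:
  assumes "sorted_wrt (>) n" "0 \<notin> set n"
  obtains k where "n = map Suc k" "sorted_wrt (>) k"
proof
  have "map Suc (map (\<lambda>i. i - 1) n) = map id n"
    unfolding map_map using assms(2) by (intro map_cong) (auto intro!: Suc_pred gr0I)
  then show n: "n = map Suc (map (\<lambda>i. i - 1) n)" by simp
  show "sorted_wrt (>) (map (\<lambda>i. i - 1) n)"
    using assms(1) by (subst (asm) n) (simp add: sorted_wrt_map)
qed

lemma sorted_Suc_snoc_0:
  assumes "sorted_wrt (>) n" "0 \<in> set n"
  obtains k where "n = map Suc k @ [0]" "sorted_wrt (>) k"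
proof -
  from assms(2) have n: "n = butlast n @ [last n]" by (cases n rule: rev_cases) auto
  have gt: "sorted_wrt (>) (butlast n)" "\<forall>k\<in>set (butlast n). k > last n"
    using assms(1) by (subst (asm) n, simp add: sorted_wrt_append)+
  have "0 \<notin> set (butlast n)" using gt(2) by auto
  moreover have "0 \<in> set (butlast n @ [last n])" using assms(2) n by simp
  ultimately have "last n = 0" by auto
  with sorted_Suc[OF gt(1) \<open>0 \<notin> set (butlast n)\<close>] n that show ?thesis by metis
qed

text \<open>The entries after position \<open>j\<close> are distinct naturals below
  \<open>n ! j\<close>. This makes the truncated subtraction in \<open>maya_partition\<close>
  exact.\<close>

lemma length_le_sorted:
  fixes n :: "nat list"
  assumes "sorted_wrt (>) n" "j < length n"
  shows "length n \<le> n ! j + j + 1"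
  using assms
proof (induction n arbitrary: j)
  case (Cons a n)
  show ?case
  proof (cases j)
    case 0
    show ?thesis
    proof (cases n)
      case (Cons b l)
      with Cons.IH[of 0] Cons.prems 0 show ?thesis by auto
    qed (use 0 in simp)
  next
    case (Suc i)
    with Cons.IH[of i] Cons.prems show ?thesis by auto
  qed
qed simp

lemma maya_partition_reduced:
  assumes "sorted_wrt (>) n" "0 \<notin> set n"
  shows "maya_t (maya_of [] n) = 0"
    and "maya_partition (maya_of [] n) = map (\<lambda>j. n ! j + (j + 1) - length n) [0..<length n]"
proof -
  have "{..<0} \<subseteq> maya_shift (maya_of [] n) 0 \<and> 0 \<notin> maya_shift (maya_of [] n) 0"
    using assms(2) by (auto simp: mem_maya_shift mem_maya_of)
  then show t: "maya_t (maya_of [] n) = 0"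
    unfolding maya_t_def by (rule the1_equality[OF maya_t_unique[OF maya_diagram_maya_of]])
  have "rev (sorted_list_of_set (set n)) = n"
  proof -
    have "sorted_wrt (<) (rev n)" using assms(1) by (simp add: sorted_wrt_rev)
    then have "sorted_list_of_set (set (rev n)) = rev n"
      by (intro sorted_list_of_set.idem_if_sorted_distinct) (auto simp: strict_sorted_iff)
    then show ?thesis by simp
  qed
  moreover have "nat ` (maya_shift (maya_of [] n) 0 \<inter> {0..}) = set n"
    by (simp add: maya_shift_def maya_of_nonneg image_image)
  ultimately show "maya_partition (maya_of [] n) = map (\<lambda>j. n ! j + (j + 1) - length n) [0..<length n]"
    by (simp add: maya_partition_def t Let_def)
qed

definition maya_omega :: "real \<Rightarrow> int set \<Rightarrow> int set \<Rightarrow> real \<Rightarrow> real" where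
  "maya_omega \<alpha> M\<^sub>1 M\<^sub>2 x = alt (tri (int (length (maya_partition M\<^sub>2)))) *
     generalized_laguerre (\<alpha> - of_int (maya_t M\<^sub>1) - of_int (maya_t M\<^sub>2)) (maya_partition M\<^sub>1) (maya_partition M\<^sub>2) x"

text \<open>Shifting a diagram by 1 lowers its t by 1 and keeps its partition, so a compensating
  change of \<alpha> leaves \<alpha> - t_1 - t_2 fixed.\<close>

lemma maya_omega_remove:
  "maya_omega \<alpha> (maya_of n' (map Suc n @ [0])) M\<^sub>2 x = maya_omega (\<alpha> + 1) (maya_of (map Suc n') n) M\<^sub>2 x"
  "maya_omega \<alpha> (maya_of (map Suc n' @ [0]) n) M\<^sub>2 x = maya_omega (\<alpha> - 1) (maya_of n' (map Suc n)) M\<^sub>2 x"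
  "maya_omega \<alpha> M\<^sub>1 (maya_of m' (map Suc m @ [0])) x = maya_omega (\<alpha> + 1) M\<^sub>1 (maya_of (map Suc m') m) x"
  "maya_omega \<alpha> M\<^sub>1 (maya_of (map Suc m' @ [0]) m) x = maya_omega (\<alpha> - 1) M\<^sub>1 (maya_of m' (map Suc m)) x"
  unfolding maya_omega_def maya_of_Suc_left maya_of_Suc_right
  by (simp_all add: maya_t_shift maya_partition_shift maya_diagram_maya_of algebra_simps)

definition lag_identity :: "real \<Rightarrow> nat list \<Rightarrow> nat list \<Rightarrow> nat list \<Rightarrow> nat list \<Rightarrow> real \<Rightarrow> bool" where
  "lag_identity \<alpha> n m m' n' x \<longleftrightarrow>
     lag_wronskian \<alpha> n m m' n' x = maya_const \<alpha> n m m' n' * maya_omega \<alpha> (maya_of n' n) (maya_of m' m) x"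

lemma lag_identity_reduced:
  assumes x: "x > 0" and "sorted_wrt (>) n" "0 \<notin> set n" "sorted_wrt (>) m" "0 \<notin> set m"
  shows "lag_identity \<alpha> n m [] [] x"
proof -
  have *: "map (\<lambda>j. L ((l ! j + (j + 1) - length l) + (length l - (j + 1)))) [0..<length l] = map L l"
    if "sorted_wrt (>) l" for l and L :: "nat \<Rightarrow> real \<Rightarrow> real"
    using length_le_sorted[OF that] by (intro nth_equalityI) auto
  have "map (lag_fun \<alpha>) (lag_list n m [] []) =
      map (\<lambda>k x. laguerre \<alpha> k x) n @ map (\<lambda>k x. exp x * laguerre \<alpha> k (- x)) m"
    by (simp add: lag_list_def fun_eq_iff)
  also have "map (\<lambda>k x. laguerre \<alpha> k x) n = map (\<lambda>j x. laguerre \<alpha>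
      (maya_partition (maya_of [] n) ! j + (length n - (j + 1))) x) [0..<length n]"
    unfolding maya_partition_reduced(2)[OF assms(2,3)]
    by (subst *[OF assms(2), symmetric]) simp
  also have "map (\<lambda>k x. exp x * laguerre \<alpha> k (- x)) m = map (\<lambda>j x. exp x * laguerre \<alpha>
      (maya_partition (maya_of [] m) ! j + (length m - (j + 1))) (- x)) [0..<length m]"
    unfolding maya_partition_reduced(2)[OF assms(4,5)]
    by (subst *[OF assms(4), symmetric]) simp
  finally have "lag_wronskian \<alpha> n m [] [] x =
      generalized_laguerre \<alpha> (maya_partition (maya_of [] n)) (maya_partition (maya_of [] m)) x"
    unfolding generalized_laguerre_def lag_wronskian_def using x
    by (simp add: maya_partition_reduced[OF assms(2,3)] maya_partition_reduced[OF assms(4,5)] Let_def)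
  then show ?thesis
    \<comment> \<open>Here \<open>mu\<close> has as many parts as \<open>m\<close> has entries, so
      the triangular signs in \<open>maya_const\<close> and \<open>maya_omega\<close>
      cancel.\<close>
    using alt_self[of "tri (int (length m))"]
    by (simp add: lag_identity_def maya_const_def maya_omega_def maya_sign_def prod_pairs_Nil_right
      maya_partition_reduced[OF assms(2,3)] maya_partition_reduced[OF assms(4,5)])
qed

text \<open>The second direction divides by both products. The one over k + 1 never vanishes, so
  only the other needs a hypothesis.\<close>

lemma lag_identity_remove_n:
  assumes "x > 0"
  shows "lag_identity (\<alpha> + 1) n m m' (map Suc n') x \<Longrightarrow> lag_identity \<alpha> (map Suc n @ [0]) m m' n' x"
    and "lag_identity \<alpha> (map Suc n @ [0]) m m' n' x \<Longrightarrow> (\<Prod>k\<leftarrow>m'. real k - \<alpha>) \<noteq> 0 \<Longrightarrow>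
      lag_identity (\<alpha> + 1) n m m' (map Suc n') x"
  unfolding lag_identity_def lag_wronskian_remove_n[OF assms] maya_const_remove_n maya_omega_remove(1)
  by (auto simp: prod_list_zero_iff)

lemma lag_identity_remove_m:
  assumes "x > 0"
  shows "lag_identity (\<alpha> + 1) n m (map Suc m') n' x \<Longrightarrow> lag_identity \<alpha> n (map Suc m @ [0]) m' n' x"
    and "lag_identity \<alpha> n (map Suc m @ [0]) m' n' x \<Longrightarrow> (\<Prod>k\<leftarrow>n'. real k - \<alpha>) \<noteq> 0 \<Longrightarrow>
      lag_identity (\<alpha> + 1) n m (map Suc m') n' x"
  unfolding lag_identity_def lag_wronskian_remove_m[OF assms] maya_const_remove_m maya_omega_remove(3)
  by (auto simp: prod_list_zero_iff)

lemma lag_identity_remove_m':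
  assumes "x > 0" "lag_identity (\<alpha> - 1) n (map Suc m) m' n' x"
  shows "lag_identity \<alpha> n m (map Suc m' @ [0]) n' x"
  using assms(2)
  unfolding lag_identity_def lag_wronskian_remove_m'[OF assms(1)] maya_const_remove_m' maya_omega_remove(4)
  by simp

lemma lag_identity_remove_n':
  assumes "x > 0" "lag_identity (\<alpha> - 1) (map Suc n) m m' n' x"
  shows "lag_identity \<alpha> n m m' (map Suc n' @ [0]) x"
  using assms(2)
  unfolding lag_identity_def lag_wronskian_remove_n'[OF assms(1)] maya_const_remove_n' maya_omega_remove(2)
  by simp

text \<open>Each removal of a final 0 from \<open>m\<close> shortens it, until the second diagram is
  reduced.\<close>

lemma lag_identity_no_holes:
  assumes "x > 0" "sorted_wrt (>) n" "0 \<notin> set n" "sorted_wrt (>) m"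
  shows "lag_identity \<alpha> n m [] [] x"
  using assms(4)
proof (induction "length m" arbitrary: m \<alpha>)
  case 0
  then show ?case using lag_identity_reduced[OF assms(1-3)] by simp
next
  case (Suc k)
  show ?case
  proof (cases "0 \<in> set m")
    case True
    then obtain l where l: "m = map Suc l @ [0]" "sorted_wrt (>) l"
      using sorted_Suc_snoc_0[OF Suc.prems] by metis
    with Suc.hyps show ?thesis
      using lag_identity_remove_m(1)[OF assms(1), of \<alpha> n l "[]" "[]"] by simp
  next
    case False
    then show ?thesis by (intro lag_identity_reduced assms Suc.prems)
  qed
qed

lemma sorted_Suc_snoc: "sorted_wrt (>) (map Suc l @ [0]) \<longleftrightarrow> sorted_wrt (>) l"
  by (simp add: sorted_wrt_append sorted_wrt_map)

text \<open>The bound \<open>T\<close> on the holes drops by 1 in each step. A hole 0 is removed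
  directly; otherwise the identity is first known with a 0 appended to \<open>m\<close> and then
  passes to the shorter Wronskian. As \<open>n'\<close> is empty, the divisor is an empty product,
  so no \<alpha> is excluded.\<close>

lemma lag_identity_second_diagram:
  assumes "x > 0" "sorted_wrt (>) n" "0 \<notin> set n"
    and "sorted_wrt (>) m" "sorted_wrt (>) m'" "\<forall>k\<in>set m'. k < T"
  shows "lag_identity \<alpha> n m m' [] x"
  using assms(4-6)
proof (induction T arbitrary: m m' \<alpha>)
  case 0
  then show ?case using lag_identity_no_holes[OF assms(1-3)] by simp
next
  case (Suc T)
  show ?case
  proof (cases "0 \<in> set m'")
    case True
    then obtain l where "m' = map Suc l @ [0]" "sorted_wrt (>) l"
      using sorted_Suc_snoc_0[OF Suc.prems(2)] by metis
    with Suc.prems show ?thesis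
      by (auto intro!: lag_identity_remove_m' assms(1) Suc.IH simp: sorted_wrt_map)
  next
    case False
    then obtain l where "m' = map Suc l" "sorted_wrt (>) l"
      using sorted_Suc[OF Suc.prems(2)] by metis
    moreover from this Suc.prems have "lag_identity (\<alpha> - 1) n (map Suc m @ [0]) l [] x"
      by (intro Suc.IH) (auto simp: sorted_Suc_snoc)
    ultimately show ?thesis
      using lag_identity_remove_m(2)[OF assms(1), of "\<alpha> - 1" n m l "[]"] by simp
  qed
qed

lemma lag_identity_first_no_holes:
  assumes "x > 0" "sorted_wrt (>) n" "sorted_wrt (>) m" "sorted_wrt (>) m'"
  shows "lag_identity \<alpha> n m m' [] x"
  using assms(2)
proof (induction "length n" arbitrary: n \<alpha>)
  case 0
  \<comment> \<open>For empty \<open>m'\<close> the value of \<open>Max\<close> is unspecified, but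
    the claim is vacuous.\<close>
  have "\<forall>k\<in>set m'. k < Suc (Max (set m'))" by (simp add: less_Suc_eq_le)
  with 0 show ?case using lag_identity_second_diagram[OF assms(1) _ _ assms(3,4)] by simp
next
  case (Suc k)
  show ?case
  proof (cases "0 \<in> set n")
    case True
    then obtain l where l: "n = map Suc l @ [0]" "sorted_wrt (>) l"
      using sorted_Suc_snoc_0[OF Suc.prems] by metis
    with Suc.hyps show ?thesis
      using lag_identity_remove_n(1)[OF assms(1), of \<alpha> l m m' "[]"] by simp
  next
    case False
    have "\<forall>k\<in>set m'. k < Suc (Max (set m'))" by (simp add: less_Suc_eq_le)
    with False show ?thesis by (intro lag_identity_second_diagram assms Suc.prems)
  qed
qed

text \<open>The same descent for the first diagram. Its divisor now runs over \<open>m'\<close> and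
  is nonzero because \<alpha> - 1 is not an integer, a property inherited along the
  induction.\<close>

lemma lag_identity_off_Ints:
  assumes "x > 0" "\<alpha> \<notin> \<int>" "sorted_wrt (>) n" "sorted_wrt (>) m" "sorted_wrt (>) m'"
    and "sorted_wrt (>) n'" "\<forall>k\<in>set n'. k < T"
  shows "lag_identity \<alpha> n m m' n' x"
  using assms(2,3,6,7)
proof (induction T arbitrary: n n' \<alpha>)
  case 0
  then show ?case using lag_identity_first_no_holes[OF assms(1) _ assms(4,5)] by simp
next
  case (Suc T)
  have \<alpha>: "\<alpha> - 1 \<notin> \<int>" using Suc.prems(1) by (metis Ints_1 Ints_add diff_add_cancel)
  show ?case
  proof (cases "0 \<in> set n'")
    case True
    then obtain l where "n' = map Suc l @ [0]" "sorted_wrt (>) l"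
      using sorted_Suc_snoc_0[OF Suc.prems(3)] by metis
    with Suc.prems \<alpha> show ?thesis
      by (auto intro!: lag_identity_remove_n' assms(1) Suc.IH simp: sorted_wrt_map)
  next
    case False
    then obtain l where "n' = map Suc l" "sorted_wrt (>) l"
      using sorted_Suc[OF Suc.prems(3)] by metis
    moreover from this Suc.prems \<alpha> have "lag_identity (\<alpha> - 1) (map Suc n @ [0]) m m' l x"
      by (intro Suc.IH) (auto simp: sorted_Suc_snoc)
    moreover have "(\<Prod>k\<leftarrow>m'. real k - (\<alpha> - 1)) \<noteq> 0"
    proof
      assume "(\<Prod>k\<leftarrow>m'. real k - (\<alpha> - 1)) = 0"
      then obtain k where "real k = \<alpha> - 1" by (auto simp: prod_list_zero_iff)
      with \<alpha> show False by (metis Ints_of_nat)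
    qed
    ultimately show ?thesis
      using lag_identity_remove_n(2)[OF assms(1), of "\<alpha> - 1" n m m' l] by simp
  qed
qed

text \<open>The partitions and t_1, t_2 do not depend on \<alpha>, so both sides are continuous in
  \<alpha> and integer parameters follow from the others.\<close>

lemma lag_identity:
  assumes x: "x > 0" and "sorted_wrt (>) n" "sorted_wrt (>) m" "sorted_wrt (>) m'" "sorted_wrt (>) n'"
  shows "lag_identity \<alpha> n m m' n' x"
proof -
  have \<Omega>: "isCont (\<lambda>\<alpha>. generalized_laguerre (\<alpha> + c) lam mu x) \<alpha>" for c lam mu \<alpha>
  proof -
    let ?l = "map (\<lambda>j. (False, False, lam ! j + (length lam - (j + 1)))) [0..<length lam] @
      map (\<lambda>j. (True, False, mu ! j + (length mu - (j + 1)))) [0..<length mu]"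
    have "generalized_laguerre \<beta> lam mu x = exp (- real (length mu) * x) * wronskian (map (lag_fun \<beta>) ?l) x" for \<beta>
      by (simp add: generalized_laguerre_def o_def Let_def) (simp add: fun_eq_iff lag_fun.simps[abs_def])
    then show ?thesis
      by (simp only:) (intro continuous_intros isCont_wronskian_lag_fun x)
  qed
  have P: "isCont (\<lambda>\<alpha>. prod_pairs (\<lambda>a b. real b - \<alpha> - real a) as bs) \<alpha>" for as bs \<alpha>
    by (simp add: prod_pairs_def prod.list_conv_set_nth) (intro continuous_intros)
  have "\<forall>k\<in>set n'. k < Suc (Max (set n'))" by (simp add: less_Suc_eq_le)
  then have off: "lag_identity \<alpha> n m m' n' x" if "\<alpha> \<notin> \<int>" for \<alpha>
    using lag_identity_off_Ints[OF x that assms(2-5)] by blast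
  show ?thesis
    unfolding lag_identity_def
  proof (rule eq_if_eq_off_Ints[where a = \<alpha> and f = "\<lambda>\<alpha>. lag_wronskian \<alpha> n m m' n' x" and
        g = "\<lambda>\<alpha>. maya_const \<alpha> n m m' n' * maya_omega \<alpha> (maya_of n' n) (maya_of m' m) x"])
    show "isCont (\<lambda>\<alpha>. lag_wronskian \<alpha> n m m' n' x) \<alpha>"
      using isCont_wronskian_lag_fun[OF x, where c = 0] x
      unfolding lag_wronskian_def by (intro continuous_intros) auto
    show "isCont (\<lambda>\<alpha>. maya_const \<alpha> n m m' n' * maya_omega \<alpha> (maya_of n' n) (maya_of m' m) x) \<alpha>"
      using \<Omega>[where c = "- of_int (maya_t (maya_of n' n)) - of_int (maya_t (maya_of m' m))"]
      unfolding maya_const_def maya_omega_def by (intro continuous_intros P) (simp add: add_diff_eq)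
  qed (use off in \<open>simp add: lag_identity_def\<close>)
qed

section \<open>Identification of the sign\<close>

text \<open>A member i forces all of 0, ..., i into \<open>I\<close>, hence i <
  \<open>card I\<close>; equal cardinalities turn this inclusion into equality.\<close>

lemma initial_segment_eq_lessThan:
  fixes I :: "nat set"
  assumes "finite I" and down: "\<And>i j. i \<in> I \<Longrightarrow> j < i \<Longrightarrow> j \<in> I"
  shows "I = {..<card I}"
proof (rule card_subset_eq)
  show "I \<subseteq> {..<card I}"
  proof
    fix i assume "i \<in> I"
    then have "{..i} \<subseteq> I" using down by (auto simp: le_less)
    then have "card {..i} \<le> card I" using assms(1) by (rule card_mono[rotated])
    then show "i \<in> {..<card I}" by simp
  qed
qed simp_all

lemma decreasing_enumeration_image:
  fixes s :: "nat \<Rightarrow> int"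
  assumes s: "\<And>i j. i < j \<Longrightarrow> s j < s i" and fin: "finite (range s \<inter> {a..})"
  shows "s ` {..<card (range s \<inter> {a..})} = range s \<inter> {a..}"
proof -
  let ?I = "{i. a \<le> s i}"
  have inj: "inj s" by (rule linorder_injI) (use s in force)
  have im: "s ` ?I = range s \<inter> {a..}" by auto
  have "finite ?I"
    using fin unfolding im[symmetric] by (rule finite_imageD) (rule inj_on_subset[OF inj], simp)
  then have "?I = {..<card ?I}"
  proof (rule initial_segment_eq_lessThan)
    fix i j assume "i \<in> ?I" "j < i"
    with s[of j i] show "j \<in> ?I" by simp
  qed
  moreover have "card ?I = card (range s \<inter> {a..})"
    unfolding im[symmetric] by (rule card_image[symmetric]) (rule inj_on_subset[OF inj], simp)
  ultimately show ?thesis using im by metis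
qed

lemma distinct_sorted_gr: "sorted_wrt (>) xs \<Longrightarrow> distinct xs" for xs :: "nat list"
  by (induction xs) auto

text \<open>Because \<open>T\<close> bounds the holes, all missing negative integers -k - 1 lie in
  this window. The full window sums to -T(T+1)/2, that is, \<open>- tri (int T + 1)\<close>.\<close>

lemma maya_of_window:
  assumes "sorted_wrt (>) n'" and T: "\<forall>k\<in>set n'. k < T"
  shows "maya_of n' n \<inter> {- int T..<0} = {- int T..<0} - (\<lambda>k. - int k - 1) ` set n'"
    and "card (maya_of n' n \<inter> {- int T..<0}) = T - length n'"
    and "length n' \<le> T"
    and "\<Sum>(maya_of n' n \<inter> {- int T..<0}) = (\<Sum>k\<leftarrow>n'. int k) + int (length n') - tri (int T + 1)"
proof -
  let ?h = "\<lambda>k. - int k - 1"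
  have sub: "?h ` set n' \<subseteq> {- int T..<0}" using T by force
  have inj: "inj_on ?h (set n')" by (auto simp: inj_on_def)
  have card: "card (?h ` set n') = length n'"
    using distinct_sorted_gr[OF assms(1)] by (simp add: card_image[OF inj] distinct_card)
  show W: "maya_of n' n \<inter> {- int T..<0} = {- int T..<0} - ?h ` set n'"
    by (force simp: mem_maya_of)
  show "card (maya_of n' n \<inter> {- int T..<0}) = T - length n'"
    unfolding W by (subst card_Diff_subset[OF _ sub]) (simp_all add: card)
  show "length n' \<le> T"
    using card_mono[OF _ sub] by (simp add: card)
  have "\<Sum>{- int T..<0} = - tri (int T + 1)"
  proof (induction T)
    case (Suc T)
    have "{- int (Suc T)..<0} = insert (- int (Suc T)) {- int T..<0}" by auto
    then show ?case using Suc tri_Suc[of "int T + 1"] by (simp add: add_ac)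
  qed (simp add: tri_def)
  moreover have "\<Sum>(?h ` set n') = (\<Sum>k\<leftarrow>n'. ?h k)"
    using distinct_sorted_gr[OF assms(1)] by (simp add: sum.reindex[OF inj] sum_list_distinct_conv_sum_set)
  moreover have "(\<Sum>k\<leftarrow>n'. ?h k) = - (\<Sum>k\<leftarrow>n'. int k) - int (length n')"
    by (induction n') simp_all
  ultimately show "\<Sum>(maya_of n' n \<inter> {- int T..<0}) = (\<Sum>k\<leftarrow>n'. int k) + int (length n') - tri (int T + 1)"
    unfolding W by (subst sum_diff[OF _ sub]) simp_all
qed

lemma card_maya_of_nonneg:
  assumes "sorted_wrt (>) n"
  shows "finite (maya_of n' n \<inter> {0..})" "card (maya_of n' n \<inter> {0..}) = length n"
  unfolding maya_of_nonneg using distinct_sorted_gr[OF assms] by (simp_all add: card_image distinct_card)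

lemma card_maya_of_from:
  assumes "sorted_wrt (>) n" "sorted_wrt (>) n'" "\<forall>k\<in>set n'. k < T"
  shows "finite (maya_of n' n \<inter> {- int T..})"
    and "card (maya_of n' n \<inter> {- int T..}) = length n + (T - length n')"
proof -
  have *: "maya_of n' n \<inter> {- int T..} = (maya_of n' n \<inter> {0..}) \<union> (maya_of n' n \<inter> {- int T..<0})"
    by auto
  show "finite (maya_of n' n \<inter> {- int T..})"
    unfolding * using card_maya_of_nonneg[OF assms(1)] by simp
  show "card (maya_of n' n \<inter> {- int T..}) = length n + (T - length n')"
    unfolding * using card_maya_of_nonneg[OF assms(1)] maya_of_window(2)[OF assms(2,3)]
    by (subst card_Un_disjoint) auto
qed

text \<open>After the \<open>length n\<close> nonnegative elements, the next
  \<open>T - length n'\<close> terms of the enumeration are exactly the elements of the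
  window.\<close>

lemma sum_maya_enum:
  assumes "sorted_wrt (>) n" "sorted_wrt (>) n'" "\<forall>k\<in>set n'. k < T"
  shows "(\<Sum>i = 1..T - length n'. maya_enum (maya_of n' n) (length n + i))
    = (\<Sum>k\<leftarrow>n'. int k) + int (length n') - tri (int T + 1)"
proof -
  let ?M = "maya_of n' n" and ?N = "T - length n'" and ?r = "length n"
  define s :: "nat \<Rightarrow> int" where "s = (THE s. (\<forall>i j. i < j \<longrightarrow> s j < s i) \<and> range s = ?M)"
  have "(\<forall>i j. i < j \<longrightarrow> s j < s i) \<and> range s = ?M"
    unfolding s_def by (rule theI'[OF maya_enum_unique[OF maya_diagram_maya_of]])
  then have s: "\<And>i j. i < j \<Longrightarrow> s j < s i" and M: "range s = ?M" by auto
  have inj: "inj s" by (rule linorder_injI) (use s in force)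
  have low: "s ` {..<?r} = ?M \<inter> {0..}"
    using decreasing_enumeration_image[of s 0, OF s] card_maya_of_nonneg[OF assms(1)] by (simp add: M)
  have high: "s ` {..<?r + ?N} = ?M \<inter> {- int T..}"
    using decreasing_enumeration_image[of s "- int T", OF s] card_maya_of_from[OF assms] by (simp add: M)
  have "(\<Sum>i = 1..?N. maya_enum ?M (?r + i)) = (\<Sum>i\<in>{..<?r + ?N} - {..<?r}. s i)"
    unfolding maya_enum_def s_def[symmetric]
    \<comment> \<open>\<open>maya_enum\<close> counts from 1 and \<open>s\<close> from 0, hence the
      offset by one.\<close>
    by (rule sum.reindex_bij_witness[of _ "\<lambda>i. Suc i - ?r" "\<lambda>i. ?r + i - 1"]) auto
  also have "\<dots> = \<Sum>(s ` ({..<?r + ?N} - {..<?r}))"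
    by (subst sum.reindex) (auto intro: inj_on_subset[OF inj])
  also have "s ` ({..<?r + ?N} - {..<?r}) = ?M \<inter> {- int T..<0}"
    unfolding image_set_diff[OF inj] low high by auto
  finally show ?thesis
    using maya_of_window(4)[OF assms(2,3)] by simp
qed

section \<open>The smallest missing integer, which is -t, and the number of parts\<close>

lemma maya_t_eqI:
  assumes "maya_diagram M" "\<And>k. k < - t \<Longrightarrow> k \<in> M" "- t \<notin> M"
  shows "maya_t M = t"
  unfolding maya_t_def
  by (rule the1_equality[OF maya_t_unique[OF assms(1)]]) (use assms in \<open>auto simp: mem_maya_shift\<close>)

lemma maya_tD:
  assumes "maya_diagram M"
  shows "k < - maya_t M \<Longrightarrow> k \<in> M" and "- maya_t M \<notin> M"
proof -
  have P: "{..<0} \<subseteq> maya_shift M (maya_t M) \<and> 0 \<notin> maya_shift M (maya_t M)"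
    unfolding maya_t_def by (rule theI') (rule maya_t_unique[OF assms])
  then show "- maya_t M \<notin> M" by (simp add: mem_maya_shift)
  assume "k < - maya_t M"
  then have "k + maya_t M \<in> {..<0}" by simp
  with P have "k + maya_t M \<in> maya_shift M (maya_t M)" by blast
  then show "k \<in> M" by (simp add: mem_maya_shift)
qed

lemma length_maya_partition_eq_card: "length (maya_partition M) = card (M \<inter> {- maya_t M..})"
proof -
  have "length (maya_partition M) = card (nat ` (maya_shift M (maya_t M) \<inter> {0..}))"
    by (simp add: maya_partition_def Let_def)
  also have "\<dots> = card (maya_shift M (maya_t M) \<inter> {0..})"
    by (rule card_image) (auto simp: inj_on_def)
  also have "maya_shift M (maya_t M) \<inter> {0..} = (\<lambda>k. k + maya_t M) ` (M \<inter> {- maya_t M..})"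
    by (auto simp: maya_shift_def)
  also have "card \<dots> = card (M \<inter> {- maya_t M..})"
    by (rule card_image) (auto simp: inj_on_def)
  finally show ?thesis .
qed

lemma maya_t_no_holes: "maya_t (maya_of [] n) \<le> 0"
  using maya_tD(2)[OF maya_diagram_maya_of, of "[]" n] by (auto simp: mem_maya_of split: if_splits)

text \<open>Without holes the smallest missing integer is -t with t at most 0. The integers 0, ...,
  -t - 1 are elements that give no part.\<close>

lemma length_maya_partition_no_holes:
  assumes "sorted_wrt (>) n"
  shows "int (length (maya_partition (maya_of [] n))) = int (length n) + maya_t (maya_of [] n)"
proof -
  let ?M = "maya_of [] n"
  let ?t = "maya_t ?M"
  have "?M \<inter> {0..} = {0..<- ?t} \<union> (?M \<inter> {- ?t..})"
    using maya_tD(1)[OF maya_diagram_maya_of, of _ "[]" n] maya_t_no_holes[of n] by force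
  moreover have "finite (?M \<inter> {- ?t..})"
    by (rule finite_subset[OF _ card_maya_of_nonneg(1)[OF assms]]) (use maya_t_no_holes[of n] in auto)
  ultimately have "card (?M \<inter> {0..}) = card {0..<- ?t} + card (?M \<inter> {- ?t..})"
    by (simp add: card_Un_disjoint disjoint_iff)
  then show ?thesis
    using maya_t_no_holes[of n] card_maya_of_nonneg(2)[OF assms, of "[]"]
    by (simp add: length_maya_partition_eq_card)
qed

lemma less_Suc_hd:
  fixes k :: nat
  assumes "sorted_wrt (>) xs" "k \<in> set xs"
  shows "k < xs ! 0 + 1"
  using assms by (cases xs) auto

text \<open>The smallest missing integer is the deepest hole, encoded by the first entry of
  \<open>n'\<close>.\<close>

lemma maya_t_holes:
  assumes "sorted_wrt (>) n'" "n' \<noteq> []"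
  shows "maya_t (maya_of n' n) = int (n' ! 0 + 1)"
proof (rule maya_t_eqI[OF maya_diagram_maya_of])
  show "k \<in> maya_of n' n" if "k < - int (n' ! 0 + 1)" for k
    using that less_Suc_hd[OF assms(1), of "nat (- k - 1)"] by (auto simp: mem_maya_of)
  show "- int (n' ! 0 + 1) \<notin> maya_of n' n"
    using assms(2) by (auto simp: mem_maya_of)
qed

lemma length_maya_partition_holes:
  assumes "sorted_wrt (>) n" "sorted_wrt (>) n'" "n' \<noteq> []"
  shows "int (length (maya_partition (maya_of n' n))) = int (length n) - int (length n') + int (n' ! 0 + 1)"
proof -
  have T: "\<forall>k\<in>set n'. k < n' ! 0 + 1" using less_Suc_hd[OF assms(2)] by blast
  show ?thesis
    using card_maya_of_from(2)[OF assms(1,2) T] maya_of_window(3)[OF assms(2) T]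
    by (simp add: length_maya_partition_eq_card maya_t_holes[OF assms(2,3)])
qed

section \<open>Comparison of the closed sign with the exponent d\<close>

lemma first_sign:
  assumes "sorted_wrt (>) n" "sorted_wrt (>) n'" "n' \<noteq> []"
  shows "int (length n') * (int (length n') - 1) div 2 + int (length n) * int (length n')
      + (int (n' ! 0) + 1 - int (length n')) * (int (n' ! 0) + 2 + int (length n')) div 2
      + (\<Sum>i = 1..n' ! 0 + 1 - length n'. maya_enum (maya_of n' n) (length n + i))
    = int (length n) * int (length n') + (\<Sum>k\<leftarrow>n'. int k)"
proof -
  let ?T = "int (n' ! 0) + 1" and ?r = "int (length n')"
  have T: "\<forall>k\<in>set n'. k < n' ! 0 + 1" using less_Suc_hd[OF assms(2)] by blast
  \<comment> \<open>The quotient is a difference of triangular numbers: \<open>tri (?T + 1)\<close>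
    cancels against the sum over the window, \<open>tri (?r + 1)\<close> against the remaining
    terms. The equality is exact, not only modulo 2.\<close>
  have "(?T - ?r) * (int (n' ! 0) + 2 + ?r) = 2 * (tri (?T + 1) - tri (?r + 1))"
    unfolding right_diff_distrib two_tri by (simp add: algebra_simps)
  then have "(?T - ?r) * (int (n' ! 0) + 2 + ?r) div 2 = tri (?T + 1) - tri (?r + 1)"
    by simp
  then show ?thesis
    using sum_maya_enum[OF assms(1,2) T] tri_Suc[of ?r] by (simp add: tri_def[of ?r, symmetric] add_ac)
qed

text \<open>With u = |t| and q parts, \<open>length m\<close> is q + u. Expanding
  \<open>tri (q + u)\<close> and using 2 tri u = u(u - 1), the difference is -2 tri q.\<close>

lemma second_sign_no_holes:
  assumes "sorted_wrt (>) m"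
  defines "t \<equiv> maya_t (maya_of [] m)"
  shows "even (\<bar>t\<bar> * int (length m) - \<bar>t\<bar> * (\<bar>t\<bar> + 1) div 2
    - (tri (int (length m)) + tri (int (length (maya_partition (maya_of [] m))))))"
proof -
  define u q where "u = \<bar>t\<bar>" and "q = int (length (maya_partition (maya_of [] m)))"
  have m: "int (length m) = q + u"
    using length_maya_partition_no_holes[OF assms(1)] maya_t_no_holes[of m] by (simp add: u_def q_def t_def)
  have "u * (u + 1) div 2 = tri (u + 1)" by (simp add: tri_def mult.commute)
  then have "u * int (length m) - u * (u + 1) div 2 - (tri (int (length m)) + tri q) = 2 * (- tri q)"
    using two_tri[of u] unfolding m tri_add[of q u] tri_Suc by (simp add: algebra_simps)
  then show ?thesis unfolding u_def q_def by (rule dvdI)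
qed

text \<open>The number of parts is c + T. Expanding \<open>tri (c + T)\<close> as before leaves the
  difference -2 tri c.\<close>

lemma second_sign_holes:
  assumes "sorted_wrt (>) m" "sorted_wrt (>) m'" "m' \<noteq> []"
  shows "even (int (length m) * (int (m' ! 0) + 1) + (int (m' ! 0) + 1) * (int (m' ! 0) + 1 - int (length m'))
      + (\<Sum>i = 1..m' ! 0 + 1 - length m'. maya_enum (maya_of m' m) (length m + i))
    - (tri (int (length m) - int (length m')) + (\<Sum>k\<leftarrow>m'. int k) + int (length m')
      + tri (int (length (maya_partition (maya_of m' m))))))"
proof -
  define T c where "T = int (m' ! 0) + 1" and "c = int (length m) - int (length m')"
  have T: "\<forall>k\<in>set m'. k < m' ! 0 + 1" using less_Suc_hd[OF assms(2)] by blast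
  have q: "int (length (maya_partition (maya_of m' m))) = c + T"
    using length_maya_partition_holes[OF assms] by (simp add: c_def T_def)
  have S: "(\<Sum>i = 1..m' ! 0 + 1 - length m'. maya_enum (maya_of m' m) (length m + i))
      = (\<Sum>k\<leftarrow>m'. int k) + int (length m') - tri (T + 1)"
    using sum_maya_enum[OF assms(1,2) T] by (simp add: T_def)
  have "int (length m) * T + T * (T - int (length m')) = c * T + T * T"
    by (simp add: c_def algebra_simps)
  then have "int (length m) * T + T * (T - int (length m'))
      + ((\<Sum>k\<leftarrow>m'. int k) + int (length m') - tri (T + 1))
      - (tri c + (\<Sum>k\<leftarrow>m'. int k) + int (length m') + tri (c + T)) = 2 * (- tri c)"
    using two_tri[of T] unfolding tri_add[of c T] tri_Suc by (simp add: algebra_simps)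
  then show ?thesis
    unfolding S q T_def c_def by (rule dvdI)
qed

theorem theorem4p2:
  fixes \<alpha> x C :: real
    and n m m' n' :: "nat list"
    and r\<^sub>1 r\<^sub>2 r\<^sub>3 r\<^sub>4 :: nat
    and f :: "(real \<Rightarrow> real) list"
    and M\<^sub>1 M\<^sub>2 :: "int set"
    and t\<^sub>1 t\<^sub>2 d d\<^sub>0 d\<^sub>1 d\<^sub>2 :: int
    and lam mu :: "nat list"
  assumes "length n = r\<^sub>1" and "length m = r\<^sub>2" and "length m' = r\<^sub>3" and "length n' = r\<^sub>4"
    and "sorted_wrt (>) n" and "sorted_wrt (>) m" and "sorted_wrt (>) m'" and "sorted_wrt (>) n'"
    and "f =
      map (\<lambda>k x. laguerre \<alpha> k x) n @
      map (\<lambda>k x. exp x * laguerre \<alpha> k (- x)) m @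
      map (\<lambda>k x. x powr (- \<alpha>) * laguerre (- \<alpha>) k x) m' @
      map (\<lambda>k x. exp x * x powr (- \<alpha>) * laguerre (- \<alpha>) k (- x)) n'"
    and "M\<^sub>1 = maya_of n' n" and "M\<^sub>2 = maya_of m' m"
    and "lam = maya_partition M\<^sub>1" and "mu = maya_partition M\<^sub>2"
    and "t\<^sub>1 = maya_t M\<^sub>1" and "t\<^sub>2 = maya_t M\<^sub>2"
    and "d\<^sub>0 = \<bar>t\<^sub>2\<bar> * int r\<^sub>2 - \<bar>t\<^sub>2\<bar> * (\<bar>t\<^sub>2\<bar> + 1) div 2"
    and "r\<^sub>4 \<ge> 1 \<Longrightarrow> d\<^sub>1 =
      int r\<^sub>4 * (int r\<^sub>4 - 1) div 2 + int r\<^sub>1 * int r\<^sub>4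
      + (int (n' ! 0) + 1 - int r\<^sub>4) * (int (n' ! 0) + 2 + int r\<^sub>4) div 2
      + (\<Sum>i = 1..n' ! 0 + 1 - r\<^sub>4. maya_enum M\<^sub>1 (r\<^sub>1 + i))"
    and "r\<^sub>3 \<ge> 1 \<Longrightarrow> d\<^sub>2 =
      int r\<^sub>2 * (int (m' ! 0) + 1) + (int (m' ! 0) + 1) * (int (m' ! 0) + 1 - int r\<^sub>3)
      + (\<Sum>i = 1..m' ! 0 + 1 - r\<^sub>3. maya_enum M\<^sub>2 (r\<^sub>2 + i))"
    and "d =
      (if r\<^sub>3 = 0 \<and> r\<^sub>4 = 0 then d\<^sub>0
       else if r\<^sub>3 = 0 then d\<^sub>0 + d\<^sub>1
       else if r\<^sub>4 = 0 then d\<^sub>2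
       else d\<^sub>1 + d\<^sub>2)"
    and "C = (- 1) powi d
      * (\<Prod>j<r\<^sub>1. \<Prod>k<r\<^sub>3. real (m' ! k) - \<alpha> - real (n ! j))
      * (\<Prod>j<r\<^sub>2. \<Prod>k<r\<^sub>4. real (n' ! k) - \<alpha> - real (m ! j))
      * (\<Prod>j<r\<^sub>1. \<Prod>k<r\<^sub>4. real (n ! j) + real (n' ! k) + 1)
      * (\<Prod>j<r\<^sub>2. \<Prod>k<r\<^sub>3. real (m ! j) + real (m' ! k) + 1)"
    and "x > 0"
  shows "exp (- real (r\<^sub>2 + r\<^sub>4) * x) * x powr ((\<alpha> + real r\<^sub>1 + real r\<^sub>2) * (real r\<^sub>3 + real r\<^sub>4))
      * wronskian f x
    = C * generalized_laguerre (\<alpha> - of_int t\<^sub>1 - of_int t\<^sub>2) lam mu x"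
proof -
  note len = assms(1-4) and sorted = assms(5-8)
  have maya: "M\<^sub>1 = maya_of n' n" "M\<^sub>2 = maya_of m' m" by fact+
  let ?q = "int (length mu)"
  have d1: "r\<^sub>1 * r\<^sub>4 + (\<Sum>k\<leftarrow>n'. int k) = (if r\<^sub>4 = 0 then 0 else d\<^sub>1)"
  proof (cases "n' = []")
    case False
    then have "r\<^sub>4 \<ge> 1" using len by (cases n') auto
    with first_sign[OF sorted(1,4) False] assms(17) show ?thesis by (simp add: len maya)
  qed (use len in auto)
  have d2: "even ((if r\<^sub>3 = 0 then d\<^sub>0 else d\<^sub>2)
      - (tri (int r\<^sub>2 - int r\<^sub>3) + (\<Sum>k\<leftarrow>m'. int k) + int r\<^sub>3 + tri ?q))"
  proof (cases "m' = []")
    case True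
    with second_sign_no_holes[OF sorted(2)] len assms(13,15,16) maya show ?thesis by auto
  next
    case False
    then have "r\<^sub>3 \<ge> 1" using len by (cases m') auto
    with second_sign_holes[OF sorted(2,3) False] assms(13,18) show ?thesis by (simp add: len maya)
  qed
  \<comment> \<open>The four cases of d separate into a contribution of each diagram.\<close>
  have d: "d = (if r\<^sub>4 = 0 then 0 else d\<^sub>1) + (if r\<^sub>3 = 0 then d\<^sub>0 else d\<^sub>2)"
    using assms(19) by auto
  have "(- 1) powi d = alt (maya_sign n m m' n' + tri ?q)"
    unfolding alt_powi
  proof (rule alt_cong)
    show "even (d - (maya_sign n m m' n' + tri ?q))"
      using d2 unfolding d d1[symmetric] maya_sign_def len by (simp add: algebra_simps)
  qed
  then have C: "C = maya_const \<alpha> n m m' n' * alt (tri ?q)"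
    unfolding assms(20) maya_const_def prod_pairs_def prod.list_conv_set_nth alt_add
    by (simp add: len atLeast0LessThan)
  have f: "f = map (lag_fun \<alpha>) (lag_list n m m' n')"
    unfolding assms(9) lag_list_def by (simp add: fun_eq_iff)
  show ?thesis
    using lag_identity[OF \<open>x > 0\<close> sorted, of \<alpha>] assms(12-15)
    unfolding lag_identity_def lag_wronskian_def maya_omega_def C f len maya by simp
qed

end
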